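(* Let $\alpha,\beta,\gamma>-1$, $\alpha\ne\beta$, $|\alpha-\beta|<1$. The large $n$ limits of the Jacobi–Piñeiro stochastic matrices of type I and type II (see context) are the same after transposition, i.e. $$\lim_{n\to\infty}P_{I,n,n+k}=\lim_{n\to\infty}P_{II,n+k,n},\qquad k\in\{-1,0,1,2\}.$$
   Context: The monic Jacobi–Piñeiro multiple orthogonal polynomials of type II $B_{(n,m)}$ are the monic polynomials of degree $n+m$ with $$\int_0^1B_{(n,m)}(x)x^{\alpha+j}(1-x)^\gamma\,dx=0,\ 0\le j\le n-1,\qquad\int_0^1B_{(n,m)}(x)x^{\beta+j}(1-x)^\gamma\,dx=0,\ 0\le j\le m-1.$$ Put $B^{(2n)}=B_{(n,n)}$ and $B^{(2n+1)}=B_{(n+1,n)}$. The Jacobi matrix $J=(J_{k,l})_{k,l\in\mathbb N_0}$ is defined by $xB^{(k)}(x)=\sum_lJ_{k,l}B^{(l)}(x)$; $J_{k,l}=0$ unless $k-2\le l\le k+1$. The type I Jacobi–Piñeiro linear form with multi-index $\vec\nu=(\nu_1,\nu_2)$, $|\vec\nu|=\nu_1+\nu_2\ge1$, is $Q_{\vec\nu}(x)=A_{\vec\nu,1}(x)x^\alpha+A_{\vec\nu,2}(x)x^\beta$, where the polynomials $A_{\vec\nu,a}$ with $\deg A_{\vec\nu,a}\le\nu_a-1$ (zero if $\nu_a=0$) are determined by $\int_0^1Q_{\vec\nu}(x)(1-x)^\gamma x^j\,dx=0$ for $0\le j\le|\vec\nu|-2$ and $\int_0^1Q_{\vec\nu}(x)(1-x)^\gamma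 x^{|\vec\nu|-1}\,dx=1$. Put $Q^{(2n)}=Q_{(n+1,n)}$ and $Q^{(2n+1)}=Q_{(n+1,n+1)}$. The stochastic matrices of type II and type I are $$P_{II,k,l}=\frac{B^{(l)}(1)}{B^{(k)}(1)}J_{k,l},\qquad P_{I,k,l}=\frac{Q^{(l)}(1)}{Q^{(k)}(1)}J_{l,k}.$$ *)

theory Defs
  imports "HOL-Analysis.Analysis" "HOL-Computational_Algebra.Polynomial"
begin

definition is_JP_typeII ::
  "real \<Rightarrow> real \<Rightarrow> real \<Rightarrow> nat \<Rightarrow> nat \<Rightarrow> real poly \<Rightarrow> bool" where
  "is_JP_typeII \<alpha> \<beta> \<gamma> n m p \<longleftrightarrow>
     degree p = n + m \<and> lead_coeff p = 1 \<and>
     (\<forall>j<n. ((\<lambda>x. poly p x * x powr (\<alpha> + real j) * (1 - x) powr \<gamma>)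
        has_integral 0) {0..1}) \<and>
     (\<forall>j<m. ((\<lambda>x. poly p x * x powr (\<beta> + real j) * (1 - x) powr \<gamma>)
        has_integral 0) {0..1})"

definition JP_typeII :: "real \<Rightarrow> real \<Rightarrow> real \<Rightarrow> nat \<Rightarrow> nat \<Rightarrow> real poly" where
  "JP_typeII \<alpha> \<beta> \<gamma> n m = (THE p. is_JP_typeII \<alpha> \<beta> \<gamma> n m p)"

definition JP_B :: "real \<Rightarrow> real \<Rightarrow> real \<Rightarrow> nat \<Rightarrow> real poly" where
  "JP_B \<alpha> \<beta> \<gamma> k = JP_typeII \<alpha> \<beta> \<gamma> ((k + 1) div 2) (k div 2)"

lemma JP_B_even: "JP_B \<alpha> \<beta> \<gamma> (2 * n) = JP_typeII \<alpha> \<beta> \<gamma> n n"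
  and JP_B_odd: "JP_B \<alpha> \<beta> \<gamma> (2 * n + 1) = JP_typeII \<alpha> \<beta> \<gamma> (n + 1) n"
  by (simp_all add: JP_B_def)

text \<open>Row \<open>k\<close> of \<open>J\<close> is the finitely supported coefficient sequence of
  \<open>x B\<^sup>(\<^sup>k\<^sup>)(x)\<close> in the basis \<open>B\<^sup>(\<^sup>l\<^sup>)\<close>.\<close>

definition JP_J :: "real \<Rightarrow> real \<Rightarrow> real \<Rightarrow> nat \<Rightarrow> nat \<Rightarrow> real" where
  "JP_J \<alpha> \<beta> \<gamma> k = (THE c. finite {l. c l \<noteq> 0} \<and>
     [:0, 1:] * JP_B \<alpha> \<beta> \<gamma> k = (\<Sum>l | c l \<noteq> 0. smult (c l) (JP_B \<alpha> \<beta> \<gamma> l)))"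

definition JP_form :: "real \<Rightarrow> real \<Rightarrow> real poly \<times> real poly \<Rightarrow> real \<Rightarrow> real" where
  "JP_form \<alpha> \<beta> A x = poly (fst A) x * x powr \<alpha> + poly (snd A) x * x powr \<beta>"

text \<open>The disjunction with zero is needed since the zero polynomial has degree \<open>0\<close>; for \<open>\<nu>\<^sub>a = 0\<close> it
  forces \<open>A\<^sub>a = 0\<close>. The normalisation only makes sense for \<open>\<nu>1 + \<nu>2 \<ge> 1\<close>, which holds for
  all indices used below.\<close>

definition is_JP_typeI ::
  "real \<Rightarrow> real \<Rightarrow> real \<Rightarrow> nat \<Rightarrow> nat \<Rightarrow> real poly \<times> real poly \<Rightarrow> bool" where
  "is_JP_typeI \<alpha> \<beta> \<gamma> \<nu>1 \<nu>2 A \<longleftrightarrow>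
     (fst A = 0 \<or> degree (fst A) < \<nu>1) \<and> (snd A = 0 \<or> degree (snd A) < \<nu>2) \<and>
     (\<forall>j. j + 2 \<le> \<nu>1 + \<nu>2 \<longrightarrow>
        ((\<lambda>x. JP_form \<alpha> \<beta> A x * (1 - x) powr \<gamma> * x ^ j) has_integral 0) {0..1}) \<and>
     ((\<lambda>x. JP_form \<alpha> \<beta> A x * (1 - x) powr \<gamma> * x ^ (\<nu>1 + \<nu>2 - 1)) has_integral 1) {0..1}"

definition JP_typeI ::
  "real \<Rightarrow> real \<Rightarrow> real \<Rightarrow> nat \<Rightarrow> nat \<Rightarrow> real \<Rightarrow> real" where
  "JP_typeI \<alpha> \<beta> \<gamma> \<nu>1 \<nu>2 = JP_form \<alpha> \<beta> (THE A. is_JP_typeI \<alpha> \<beta> \<gamma> \<nu>1 \<nu>2 A)"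

definition JP_Q :: "real \<Rightarrow> real \<Rightarrow> real \<Rightarrow> nat \<Rightarrow> real \<Rightarrow> real" where
  "JP_Q \<alpha> \<beta> \<gamma> k = JP_typeI \<alpha> \<beta> \<gamma> (k div 2 + 1) ((k + 1) div 2)"

lemma JP_Q_even: "JP_Q \<alpha> \<beta> \<gamma> (2 * n) = JP_typeI \<alpha> \<beta> \<gamma> (n + 1) n"
  and JP_Q_odd: "JP_Q \<alpha> \<beta> \<gamma> (2 * n + 1) = JP_typeI \<alpha> \<beta> \<gamma> (n + 1) (n + 1)"
  by (simp_all add: JP_Q_def)

definition JP_P_II :: "real \<Rightarrow> real \<Rightarrow> real \<Rightarrow> nat \<Rightarrow> nat \<Rightarrow> real" where
  "JP_P_II \<alpha> \<beta> \<gamma> k l =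
     poly (JP_B \<alpha> \<beta> \<gamma> l) 1 / poly (JP_B \<alpha> \<beta> \<gamma> k) 1 * JP_J \<alpha> \<beta> \<gamma> k l"

definition JP_P_I :: "real \<Rightarrow> real \<Rightarrow> real \<Rightarrow> nat \<Rightarrow> nat \<Rightarrow> real" where
  "JP_P_I \<alpha> \<beta> \<gamma> k l =
     JP_Q \<alpha> \<beta> \<gamma> l 1 / JP_Q \<alpha> \<beta> \<gamma> k 1 * JP_J \<alpha> \<beta> \<gamma> l k"

end

theory Submission
  imports Defs "HOL-Real_Asymp.Real_Asymp"
begin

text \<open>
  For a polynomial \<open>p\<close> of degree at most \<open>N\<close>, the Mellin transform of \<open>p(x) (1 - x)\<^sup>\<gamma>\<close> on the unit interval
  is \<open>\<Gamma>(s + 1) / \<Gamma>(s + \<gamma> + N + 2)\<close> times a polynomial in \<open>s\<close> of degree at most \<open>N\<close>, and the orthogonality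
  conditions prescribe the zeros of the latter. Its leading coefficient is \<open>p(1)\<close>, and multiplication of
  \<open>p\<close> by \<open>x\<close> becomes the shift \<open>s \<mapsto> s + 1\<close>. The recurrence for \<open>B\<^sup>(\<^sup>k\<^sup>)\<close> therefore turns into an identity
  between cubic polynomials in \<open>s\<close>, whose coefficients are exactly the entries \<open>P\<^sub>I\<^sub>I(k, l)\<close>. These are nonnegative
  and tend to \<open>8/27, 12/27, 6/27, 1/27\<close> for \<open>l = k + 1, k, k - 1, k - 2\<close>.

  With \<open>u\<^sub>k = B\<^sup>(\<^sup>k\<^sup>)(1) Q\<^sup>(\<^sup>k\<^sup>)(1)\<close> we have \<open>P\<^sub>I(k, l) = (u\<^sub>l / u\<^sub>k) P\<^sub>I\<^sub>I(l, k)\<close>, so it remains to see that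
  \<open>u\<^sub>k\<^sub>+\<^sub>1 / u\<^sub>k \<rightarrow> 1\<close>. By biorthogonality \<open>u\<close> is an invariant measure of \<open>P\<^sub>I\<^sub>I\<close>. The moments of \<open>Q\<^sup>(\<^sup>k\<^sup>)\<close> are
  entries of powers of the nonnegative matrix \<open>J\<close>, and their asymptotics are governed by \<open>Q\<^sup>(\<^sup>k\<^sup>)(1)\<close>,
  so \<open>u\<close> is positive. A positive solution of a recurrence whose limiting characteristic polynomial is
  \<open>(z - 1)\<^sup>2 (z + 8)\<close> has ratios tending to \<open>1\<close>.
\<close>

section \<open>Mellin transforms of polynomials\<close>

definition node_poly :: "(nat \<Rightarrow> real) \<Rightarrow> nat \<Rightarrow> real poly" where
  "node_poly x n = (\<Prod>i<n. [:- x i, 1:])"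

lemma poly_node_poly: "poly (node_poly x n) s = (\<Prod>i<n. s - x i)"
  by (simp add: node_poly_def poly_prod)

lemma node_poly_Suc: "node_poly x (Suc n) = node_poly x n * [:- x n, 1:]"
  by (simp add: node_poly_def)

lemma node_poly_Suc_shift: "node_poly x (Suc n) = [:- x 0, 1:] * node_poly (\<lambda>i. x (Suc i)) n"
  unfolding node_poly_def by (rule prod.lessThan_Suc_shift)

lemma pcompose_node_poly: "pcompose (node_poly x n) [:c, 1:] = node_poly (\<lambda>i. x i - c) n"
  by (simp add: node_poly_def pcompose_prod pcompose_pCons)

lemma degree_node_poly [simp]: "degree (node_poly x n) = n"
  unfolding node_poly_def by (subst degree_prod_eq_sum_degree) auto

lemma coeff_node_poly [simp]: "coeff (node_poly x n) n = 1"
  using lead_coeff_prod[of "\<lambda>i. [:- x i, 1:]" "{..<n}"]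
  by (simp flip: node_poly_def)

text \<open>For \<open>degree p \<le> N\<close>, the integral of \<open>p(x) x\<^sup>s (1 - x)\<^sup>\<gamma>\<close> over the unit interval is
  \<open>\<Gamma>(\<gamma> + 1) \<Gamma>(s + 1) / \<Gamma>(s + \<gamma> + N + 2)\<close> times this polynomial in \<open>s\<close>.\<close>

primrec mellin_poly :: "real \<Rightarrow> nat \<Rightarrow> real poly \<Rightarrow> real poly" where
  "mellin_poly \<gamma> 0 p = [:coeff p 0:]"
| "mellin_poly \<gamma> (Suc N) p =
     [:real N + \<gamma> + 2, 1:] * mellin_poly \<gamma> N p +
     smult (coeff p (Suc N)) (node_poly (\<lambda>i. - real (Suc i)) (Suc N))"

lemma mellin_poly_cong:
  "(\<And>i. i \<le> N \<Longrightarrow> coeff p i = coeff q i) \<Longrightarrow> mellin_poly \<gamma> N p = mellin_poly \<gamma> N q"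
  by (induction N) auto

lemma mellin_poly_add: "mellin_poly \<gamma> N (p + q) = mellin_poly \<gamma> N p + mellin_poly \<gamma> N q"
proof (induction N)
  case (Suc N)
  show ?case
    by (subst poly_eq_poly_eq_iff [symmetric]) (auto simp: fun_eq_iff Suc algebra_simps)
qed simp

lemma mellin_poly_smult: "mellin_poly \<gamma> N (smult a p) = smult a (mellin_poly \<gamma> N p)"
  by (induction N) (simp_all add: smult_add_right del: mult_pCons_left)

lemma mellin_poly_0 [simp]: "mellin_poly \<gamma> N 0 = 0"
  by (induction N) simp_all

lemma mellin_poly_diff: "mellin_poly \<gamma> N (p - q) = mellin_poly \<gamma> N p - mellin_poly \<gamma> N q"
  using mellin_poly_add[of \<gamma> N p "smult (-1) q"]
  unfolding mellin_poly_smult by simp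

lemma degree_mellin_poly: "degree (mellin_poly \<gamma> N p) \<le> N"
proof (induction N)
  case (Suc N)
  have "degree ([:real N + \<gamma> + 2, 1:] * mellin_poly \<gamma> N p) \<le> Suc N"
    using Suc degree_mult_le[of "[:real N + \<gamma> + 2, 1:]" "mellin_poly \<gamma> N p"] by simp
  moreover have "degree (smult (coeff p (Suc N)) (node_poly (\<lambda>i. - real (Suc i)) (Suc N))) \<le> Suc N"
    by (rule order.trans[OF degree_smult_le]) simp
  ultimately show ?case
    by (simp add: degree_add_le)
qed simp

text \<open>The linear factors and node polynomials of the recursion are monic, so each step adds
  the next coefficient of \<open>p\<close> to the leading one. For degree at most \<open>N\<close>
  the sum is the value of \<open>p\<close> at 1.\<close>

lemma coeff_mellin_poly: "coeff (mellin_poly \<gamma> N p) N = (\<Sum>i\<le>N. coeff p i)"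
proof (induction N)
  case (Suc N)
  have "coeff (mellin_poly \<gamma> N p) (Suc N) = 0"
    using degree_mellin_poly[of \<gamma> N p] by (intro coeff_eq_0) simp
  thus ?case
    using Suc by (simp del: of_nat_Suc)
qed simp

lemma coeff_mellin_poly': "degree p \<le> N \<Longrightarrow> coeff (mellin_poly \<gamma> N p) N = poly p 1"
  unfolding coeff_mellin_poly poly_altdef
  by (intro sum.mono_neutral_cong_right) (auto simp: coeff_eq_0)

text \<open>At this point the linear factor of the last recursion step vanishes, so only the node
  polynomial survives. The top coefficient of \<open>p\<close> can thus be read off from its
  transform.\<close>

lemma poly_mellin_poly_lead:
  "poly (mellin_poly \<gamma> N p) (- (real N + \<gamma> + 1)) = coeff p N * (\<Prod>i<N. - (\<gamma> + 1 + real i))"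
proof (cases N)
  case (Suc M)
  have "(\<Prod>i<N. - (\<gamma> + 1 + real i)) = (\<Prod>i<N. - (\<gamma> + 1 + real (N - Suc i)))"
    by (rule prod.nat_diff_reindex [symmetric])
  also have "\<dots> = (\<Prod>i<N. - (real N + \<gamma> + 1) - - real (Suc i))"
    by (intro prod.cong) (auto simp: of_nat_diff)
  finally show ?thesis
    using Suc by (simp add: poly_node_poly algebra_simps del: prod.lessThan_Suc)
qed simp

lemma mellin_poly_extend:
  "degree p \<le> N \<Longrightarrow> mellin_poly \<gamma> (Suc N) p = [:real N + \<gamma> + 2, 1:] * mellin_poly \<gamma> N p"
  by (simp add: coeff_eq_0)

text \<open>Multiplication by x shifts s by one. The extra factor s + 1 is Gamma(s + 2) / Gamma(s +
  1), and the Gamma function in the denominator is the same on both sides.\<close>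

lemma mellin_poly_pCons:
  "mellin_poly \<gamma> (Suc N) (pCons 0 p) = [:1, 1:] * pcompose (mellin_poly \<gamma> N p) [:1, 1:]"
proof (induction N)
  case 0
  show ?case by (simp add: node_poly_def)
next
  case (Suc N)
  have np: "node_poly (\<lambda>i. - real (Suc i)) (Suc (Suc N)) =
      [:1, 1:] * pcompose (node_poly (\<lambda>i. - real (Suc i)) (Suc N)) [:1, 1:]"
    unfolding pcompose_node_poly by (subst node_poly_Suc_shift) (simp add: algebra_simps)
  have "mellin_poly \<gamma> (Suc (Suc N)) (pCons 0 p) =
      [:real (Suc N) + \<gamma> + 2, 1:] * mellin_poly \<gamma> (Suc N) (pCons 0 p) +
      smult (coeff p (Suc N)) (node_poly (\<lambda>i. - real (Suc i)) (Suc (Suc N)))"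
    by (subst mellin_poly.simps(2)) simp
  also have "\<dots> = [:1, 1:] * pcompose (mellin_poly \<gamma> (Suc N) p) [:1, 1:]"
    unfolding Suc np
    by (subst poly_eq_poly_eq_iff [symmetric]) (auto simp: fun_eq_iff poly_pcompose algebra_simps)
  finally show ?case .
qed

section \<open>Bijectivity of the transform on polynomials of bounded degree\<close>

context
  fixes \<gamma> :: real
  assumes \<gamma>: "\<gamma> > -1"
begin

text \<open>Since \<gamma> > -1, the product in \<open>poly_mellin_poly_lead\<close> is nonzero.
  This kills the top coefficient, after which the linear factor can be cancelled.\<close>

lemma mellin_poly_eq_0D: "mellin_poly \<gamma> N p = 0 \<Longrightarrow> i \<le> N \<Longrightarrow> coeff p i = 0"
proof (induction N arbitrary: i)
  case (Suc N)
  have "coeff p (Suc N) * (\<Prod>i<Suc N. - (\<gamma> + 1 + real i)) = 0"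
    by (subst poly_mellin_poly_lead [symmetric], subst Suc.prems) simp
  moreover have "(\<Prod>i<Suc N. - (\<gamma> + 1 + real i)) \<noteq> 0"
    using \<gamma> by (subst prod_zero_iff) (auto simp: add_eq_0_iff)
  ultimately have 0: "coeff p (Suc N) = 0"
    by simp
  hence "[:real N + \<gamma> + 2, 1:] * mellin_poly \<gamma> N p = 0"
    using Suc.prems by simp
  hence "mellin_poly \<gamma> N p = 0"
    unfolding mult_eq_0_iff by simp
  thus ?case
    using 0 Suc.IH Suc.prems(2) by (metis le_Suc_eq)
qed simp

lemma mellin_poly_inj:
  assumes "degree p \<le> N" "degree q \<le> N" "mellin_poly \<gamma> N p = mellin_poly \<gamma> N q"
  shows "p = q"
proof (rule poly_eqI)
  fix i
  show "coeff p i = coeff q i"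
  proof (cases "i \<le> N")
    case True
    thus ?thesis
      using mellin_poly_eq_0D[of N "p - q" i] assms by (simp add: mellin_poly_diff)
  next
    case False
    thus ?thesis
      using assms by (simp add: coeff_eq_0)
  qed
qed

lemma mellin_poly_surj:
  "degree q \<le> N \<Longrightarrow> \<exists>p. degree p \<le> N \<and> mellin_poly \<gamma> N p = q"
proof (induction N arbitrary: q)
  case 0
  thus ?case
    by (intro exI[of _ q]) (auto elim: degree_eq_zeroE)
next
  case (Suc N)
  define z where "z = - (real (Suc N) + \<gamma> + 1)"
  define w where "w = node_poly (\<lambda>i. - real (Suc i)) (Suc N)"
  \<comment> \<open>The point \<open>z\<close> is the zero of the linear factor in the recursion.
    Subtracting this multiple of \<open>w\<close> creates a zero there, so that the factor divides
    what remains.\<close>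
  define a where "a = poly q z / poly w z"
  have "poly w z \<noteq> 0"
    unfolding w_def poly_node_poly z_def using \<gamma> by (subst prod_zero_iff) auto
  hence "poly (q - smult a w) z = 0"
    by (simp add: a_def)
  hence "[:- z, 1:] dvd q - smult a w"
    unfolding poly_eq_0_iff_dvd .
  then obtain q' where q': "q - smult a w = [:- z, 1:] * q'"
    by (elim dvdE)
  have "degree (q - smult a w) \<le> Suc N"
    using Suc.prems
    by (intro degree_diff_le) (auto simp: w_def)
  have "degree q' \<le> N"
  proof (cases "q' = 0")
    case False
    have "degree ([:- z, 1:] * q') = Suc (degree q')"
      using False by (subst degree_mult_eq) auto
    thus ?thesis
      using \<open>degree (q - smult a w) \<le> Suc N\<close> q' by simp
  qed simp
  then obtain p where p: "degree p \<le> N" "mellin_poly \<gamma> N p = q'"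
    using Suc.IH by blast
  define p' where "p' = p + monom a (Suc N)"
  have "degree p' \<le> Suc N"
    unfolding p'_def using p(1) by (intro degree_add_le) (auto intro: degree_monom_le)
  moreover have "mellin_poly \<gamma> N p' = mellin_poly \<gamma> N p"
    by (intro mellin_poly_cong) (auto simp: p'_def)
  hence "mellin_poly \<gamma> (Suc N) p' = [:- z, 1:] * q' + smult a w"
    using p by (simp add: p'_def z_def w_def coeff_eq_0 algebra_simps)
  hence "mellin_poly \<gamma> (Suc N) p' = q"
    unfolding q' [symmetric] by simp
  ultimately show ?case
    by blast
qed

end

section \<open>The transform as an integral and its asymptotics on monomials\<close>

lemma power_mult_powr: "x \<ge> 0 \<Longrightarrow> x ^ i * x powr s = x powr (s + real i)" for x s :: real
  by (cases "x = 0") (simp_all add: powr_add powr_realpow)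

definition mellin :: "real \<Rightarrow> real poly \<Rightarrow> real \<Rightarrow> real" where
  "mellin \<gamma> p s = integral {0..1} (\<lambda>x. poly p x * x powr s * (1 - x) powr \<gamma>)"

context
  fixes \<gamma> :: real
  assumes \<gamma>: "\<gamma> > -1"
begin

lemma has_integral_power_beta:
  assumes "s > -1"
  shows "((\<lambda>x. x ^ i * x powr s * (1 - x) powr \<gamma>) has_integral Beta (s + real i + 1) (\<gamma> + 1)) {0..1}"
proof -
  have "((\<lambda>x. x powr (s + real i + 1 - 1) * (1 - x) powr (\<gamma> + 1 - 1))
          has_integral Beta (s + real i + 1) (\<gamma> + 1)) {0..1}"
    using assms \<gamma> by (intro has_integral_Beta_real) auto
  thus ?thesis
    by (rule has_integral_eq [rotated]) (simp add: power_mult_powr)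
qed

text \<open>Truncating the sum allows an induction on \<open>N\<close> with \<open>p\<close> fixed.
  A new monomial contributes a Beta integral, and Gamma(t + 1) = t Gamma(t) puts the old terms over
  the new denominator.\<close>

lemma has_integral_truncated_poly:
  assumes s: "s > -1"
  shows "((\<lambda>x. (\<Sum>i\<le>N. coeff p i * x ^ i) * x powr s * (1 - x) powr \<gamma>) has_integral
           Gamma (\<gamma> + 1) * Gamma (s + 1) / Gamma (s + \<gamma> + real N + 2) * poly (mellin_poly \<gamma> N p) s) {0..1}"
proof (induction N)
  case 0
  show ?case
    using has_integral_mult_right[OF has_integral_power_beta[OF s, of 0], of "coeff p 0"]
    by (simp add: Beta_def algebra_simps)
next
  case (Suc N)
  define t where "t = s + \<gamma> + real N + 2"
  have t: "t > 0"
    using s \<gamma> by (simp add: t_def)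
  have G: "Gamma (t + 1) = t * Gamma t"
    using t by (intro Gamma_plus1) (auto elim!: nonpos_Ints_cases)
  have "pochhammer (s + 1) (Suc N) = Gamma (s + 1 + real (Suc N)) / Gamma (s + 1)"
    using s by (intro pochhammer_Gamma) (auto elim!: nonpos_Ints_cases)
  moreover have "pochhammer (s + 1) (Suc N) = poly (node_poly (\<lambda>i. - real (Suc i)) (Suc N)) s"
    by (simp add: poly_node_poly pochhammer_prod algebra_simps lessThan_atLeast0)
  moreover have "Gamma (s + 1) > 0"
    using s by simp
  ultimately have "Beta (s + real (Suc N) + 1) (\<gamma> + 1) =
      Gamma (\<gamma> + 1) * Gamma (s + 1) * poly (node_poly (\<lambda>i. - real (Suc i)) (Suc N)) s / Gamma (t + 1)"
    by (simp add: Beta_def t_def field_simps)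
  hence "coeff p (Suc N) * Beta (s + real (Suc N) + 1) (\<gamma> + 1) =
      Gamma (\<gamma> + 1) * Gamma (s + 1) / Gamma (t + 1) *
        (coeff p (Suc N) * poly (node_poly (\<lambda>i. - real (Suc i)) (Suc N)) s)"
    by simp
  moreover have "Gamma (\<gamma> + 1) * Gamma (s + 1) / Gamma t * poly (mellin_poly \<gamma> N p) s =
      Gamma (\<gamma> + 1) * Gamma (s + 1) / Gamma (t + 1) * (t * poly (mellin_poly \<gamma> N p) s)"
    unfolding G using t by simp
  moreover have "poly (mellin_poly \<gamma> (Suc N) p) s =
      t * poly (mellin_poly \<gamma> N p) s + coeff p (Suc N) * poly (node_poly (\<lambda>i. - real (Suc i)) (Suc N)) s"
    by (simp add: t_def algebra_simps)
  moreover have "s + \<gamma> + real (Suc N) + 2 = t + 1"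
    by (simp add: t_def)
  ultimately have eq: "Gamma (\<gamma> + 1) * Gamma (s + 1) / Gamma (s + \<gamma> + real (Suc N) + 2) *
        poly (mellin_poly \<gamma> (Suc N) p) s =
      Gamma (\<gamma> + 1) * Gamma (s + 1) / Gamma t * poly (mellin_poly \<gamma> N p) s +
      coeff p (Suc N) * Beta (s + real (Suc N) + 1) (\<gamma> + 1)"
    by (simp only: distrib_left)
  show ?case
    unfolding eq
    using has_integral_add[OF Suc
        has_integral_mult_right[OF has_integral_power_beta[OF s, of "Suc N"], of "coeff p (Suc N)"]]
    by (simp add: t_def algebra_simps)
qed

lemma has_integral_mellin_poly:
  assumes "s > -1" "degree p \<le> N"
  shows "((\<lambda>x. poly p x * x powr s * (1 - x) powr \<gamma>) has_integral
           Gamma (\<gamma> + 1) * Gamma (s + 1) / Gamma (s + \<gamma> + real N + 2) * poly (mellin_poly \<gamma> N p) s) {0..1}"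
proof -
  have "poly p x = (\<Sum>i\<le>N. coeff p i * x ^ i)" for x
    unfolding poly_altdef using assms(2)
    by (intro sum.mono_neutral_left) (auto simp: coeff_eq_0)
  thus ?thesis
    using has_integral_truncated_poly[OF assms(1), of p N] by simp
qed

lemma has_integral_mellin:
  "s > -1 \<Longrightarrow> ((\<lambda>x. poly p x * x powr s * (1 - x) powr \<gamma>) has_integral mellin \<gamma> p s) {0..1}"
  using has_integral_mellin_poly[of s p "degree p"]
  unfolding mellin_def by (blast intro: integrable_integral)

lemma has_integral_mellin_iff:
  "s > -1 \<Longrightarrow> ((\<lambda>x. poly p x * x powr s * (1 - x) powr \<gamma>) has_integral I) {0..1} \<longleftrightarrow> mellin \<gamma> p s = I"
  using has_integral_mellin has_integral_unique by blast

lemma mellin_altdef: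
  "s > -1 \<Longrightarrow> degree p \<le> N \<Longrightarrow>
     mellin \<gamma> p s = Gamma (\<gamma> + 1) * Gamma (s + 1) / Gamma (s + \<gamma> + real N + 2) * poly (mellin_poly \<gamma> N p) s"
  using has_integral_mellin_poly has_integral_mellin has_integral_unique by blast

lemma mellin_eq_0_iff:
  assumes "s > -1" "degree p \<le> N"
  shows "mellin \<gamma> p s = 0 \<longleftrightarrow> poly (mellin_poly \<gamma> N p) s = 0"
proof -
  have "Gamma (\<gamma> + 1) > 0" "Gamma (s + 1) > 0" "Gamma (s + \<gamma> + real N + 2) > 0"
    using assms \<gamma> by (auto intro: Gamma_real_pos)
  thus ?thesis
    using mellin_altdef[OF assms] by simp
qed

lemma mellin_add: "s > -1 \<Longrightarrow> mellin \<gamma> (p + q) s = mellin \<gamma> p s + mellin \<gamma> q s"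
  using has_integral_add[OF has_integral_mellin[of s p] has_integral_mellin[of s q]]
  by (subst has_integral_mellin_iff [symmetric]) (simp_all add: algebra_simps)

lemma mellin_smult: "s > -1 \<Longrightarrow> mellin \<gamma> (smult a p) s = a * mellin \<gamma> p s"
  using has_integral_mult_right[OF has_integral_mellin[of s p], of a]
  by (subst has_integral_mellin_iff [symmetric]) (simp_all add: algebra_simps)

lemma mellin_0: "mellin \<gamma> 0 s = 0"
  by (simp add: mellin_def)

lemma mellin_sum: "s > -1 \<Longrightarrow> mellin \<gamma> (\<Sum>i\<in>A. p i) s = (\<Sum>i\<in>A. mellin \<gamma> (p i) s)"
  by (induction A rule: infinite_finite_induct) (simp_all add: mellin_0 mellin_add)

lemma mellin_pCons: "mellin \<gamma> (pCons 0 p) s = mellin \<gamma> p (s + 1)"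
  unfolding mellin_def
proof (rule integral_cong)
  fix x :: real assume "x \<in> {0..1}"
  thus "poly (pCons 0 p) x * x powr s * (1 - x) powr \<gamma> = poly p x * x powr (s + 1) * (1 - x) powr \<gamma>"
    using power_mult_powr[of x 1 s] by simp
qed

lemma mellin_monom: "s > -1 \<Longrightarrow> mellin \<gamma> (monom 1 M) s = Beta (s + real M + 1) (\<gamma> + 1)"
  using has_integral_power_beta[of s M]
  by (subst has_integral_mellin_iff [symmetric]) (simp_all add: poly_monom)

text \<open>The quotient of Gamma functions is a quotient of two Gamma series. The limit does not
  depend on \<open>s\<close>: high moments see only the behaviour at x = 1, where every power of x
  equals 1.\<close>

lemma mellin_monom_asymp:
  assumes "s > -1"
  shows "(\<lambda>M. real M powr (\<gamma> + 1) * mellin \<gamma> (monom 1 (Suc M)) s) \<longlonglongrightarrow> Gamma (\<gamma> + 1)"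
proof -
  define G where "G = (\<lambda>M. Gamma_series (s + \<gamma> + 2) M / Gamma_series (s + 1) M)"
  have pos: "Gamma (s + 1) > 0" "Gamma (s + \<gamma> + 2) > 0"
    using assms \<gamma> by (auto intro: Gamma_real_pos)
  have "G \<longlonglongrightarrow> Gamma (s + \<gamma> + 2) / Gamma (s + 1)"
    unfolding G_def using pos by (intro tendsto_intros) auto
  hence "(\<lambda>M. Gamma (\<gamma> + 1) * (Gamma (s + 1) / Gamma (s + \<gamma> + 2) * G M)) \<longlonglongrightarrow>
      Gamma (\<gamma> + 1) * (Gamma (s + 1) / Gamma (s + \<gamma> + 2) * (Gamma (s + \<gamma> + 2) / Gamma (s + 1)))"
    by (intro tendsto_intros)
  hence lim: "(\<lambda>M. Gamma (\<gamma> + 1) * (Gamma (s + 1) / Gamma (s + \<gamma> + 2) * G M)) \<longlonglongrightarrow> Gamma (\<gamma> + 1)"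
    using pos by simp
  have "Gamma (\<gamma> + 1) * (Gamma (s + 1) / Gamma (s + \<gamma> + 2) * G M) =
          real M powr (\<gamma> + 1) * mellin \<gamma> (monom 1 (Suc M)) s" if "M > 0" for M
  proof -
    have ph: "pochhammer (s + 1) (Suc M) = Gamma (s + 1 + real (Suc M)) / Gamma (s + 1)"
      using assms by (intro pochhammer_Gamma) (auto elim!: nonpos_Ints_cases)
    have ph': "pochhammer (s + \<gamma> + 2) (Suc M) = Gamma (s + \<gamma> + 2 + real (Suc M)) / Gamma (s + \<gamma> + 2)"
      using assms \<gamma> by (intro pochhammer_Gamma) (auto elim!: nonpos_Ints_cases)
    have "G M = real M powr (\<gamma> + 1) * (pochhammer (s + 1) (Suc M) / pochhammer (s + \<gamma> + 2) (Suc M))"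
      using that
      by (simp add: G_def Gamma_series_def powr_def exp_add [symmetric] exp_diff [symmetric] divide_simps)
         (simp add: exp_add [symmetric] algebra_simps)
    moreover have "Gamma (1 + s) \<noteq> 0"
      using pos(1) by (metis add.commute less_irrefl)
    ultimately show ?thesis
      using assms pos(2) unfolding ph ph'
      by (simp add: mellin_monom Beta_def field_simps)
  qed
  thus ?thesis
    by (intro Lim_transform_eventually[OF lim] eventually_mono[OF eventually_gt_at_top[of 0]]) auto
qed

end

section \<open>Type II polynomials on the step line\<close>

lemma monic_basis:
  fixes B :: "nat \<Rightarrow> 'a::comm_ring_1 poly"
  assumes deg: "\<And>j. degree (B j) = j" and monic: "\<And>j. coeff (B j) j = 1" and "degree p \<le> N"
  shows "\<exists>b. p = (\<Sum>j\<le>N. smult (b j) (B j))"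
  using assms(3)
proof (induction N arbitrary: p)
  case 0
  have "B 0 = 1"
    using deg[of 0] monic[of 0] by (metis degree_eq_zeroE coeff_pCons_0 one_pCons)
  thus ?case
    using 0 by (intro exI[of _ "\<lambda>_. coeff p 0"]) (auto elim: degree_eq_zeroE)
next
  case (Suc N)
  define q where "q = p - smult (coeff p (Suc N)) (B (Suc N))"
  have "degree q \<le> N"
  proof (rule degree_le, intro allI impI)
    fix i assume "i > N"
    thus "coeff q i = 0"
      using Suc.prems deg[of "Suc N"] monic[of "Suc N"]
      by (cases "i = Suc N") (auto simp: q_def coeff_eq_0)
  qed
  then obtain b where b: "q = (\<Sum>j\<le>N. smult (b j) (B j))"
    using Suc.IH by blast
  have "p = (\<Sum>j\<le>Suc N. smult ((b(Suc N := coeff p (Suc N))) j) (B j))"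
    using b by (simp add: q_def algebra_simps)
  thus ?case
    by blast
qed

lemma monic_independent:
  fixes B :: "nat \<Rightarrow> 'a::comm_ring_1 poly"
  assumes deg: "\<And>j. degree (B j) = j" and monic: "\<And>j. coeff (B j) j = 1"
    and "(\<Sum>j\<le>N. smult (b j) (B j)) = 0" "j \<le> N"
  shows "b j = 0"
  using assms(3,4)
proof (induction N arbitrary: j)
  case 0
  hence "coeff (smult (b 0) (B 0)) 0 = 0"
    by simp
  thus ?case
    using 0 monic[of 0] by simp
next
  case (Suc N)
  have "0 = coeff (\<Sum>j\<le>Suc N. smult (b j) (B j)) (Suc N)"
    using Suc.prems by simp
  also have "\<dots> = b (Suc N)"
    using deg monic by (simp add: coeff_sum coeff_eq_0)
  finally have b: "b (Suc N) = 0"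
    by simp
  thus ?case
    using Suc by (cases "j = Suc N") auto
qed

text \<open>This justifies the definite description by which \<open>JP_J\<close> is defined.\<close>

lemma finite_expansion_unique:
  fixes B :: "nat \<Rightarrow> 'a::comm_ring_1 poly"
  assumes deg: "\<And>j. degree (B j) = j" and monic: "\<And>j. coeff (B j) j = 1"
    and fin: "finite {l. c l \<noteq> 0}" "finite {l. d l \<noteq> 0}"
    and eq: "(\<Sum>l | c l \<noteq> 0. smult (c l) (B l)) = (\<Sum>l | d l \<noteq> 0. smult (d l) (B l))"
  shows "c = d"
proof
  fix l
  obtain N where N: "{l. c l \<noteq> 0} \<union> {l. d l \<noteq> 0} \<union> {l} \<subseteq> {..N}"
    using fin finite_nat_set_iff_bounded_le[of "{l. c l \<noteq> 0} \<union> {l. d l \<noteq> 0} \<union> {l}"] by auto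
  have "(\<Sum>l | c l \<noteq> 0. smult (c l) (B l)) = (\<Sum>l\<le>N. smult (c l) (B l))"
    using N by (intro sum.mono_neutral_left) auto
  moreover have "(\<Sum>l | d l \<noteq> 0. smult (d l) (B l)) = (\<Sum>l\<le>N. smult (d l) (B l))"
    using N by (intro sum.mono_neutral_left) auto
  ultimately have "(\<Sum>l\<le>N. smult (c l - d l) (B l)) = 0"
    using eq by (simp add: smult_diff_left sum_subtractf)
  thus "c l = d l"
    using monic_independent[OF deg monic, where b = "\<lambda>l. c l - d l" and N = N and j = l] N by simp
qed

text \<open>Back substitution: the last equation involves only the last unknown. It will be applied
  to the integrals of \<open>B j\<close> against x to the power \<open>r i\<close>.\<close>

lemma triangular_unique:
  fixes T :: "nat \<Rightarrow> nat \<Rightarrow> real"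
  assumes "\<And>i j. i < j \<Longrightarrow> j \<le> n \<Longrightarrow> T j i = 0" "\<And>j. j \<le> n \<Longrightarrow> T j j \<noteq> 0"
    and "\<And>j. j \<le> n \<Longrightarrow> (\<Sum>i\<le>n. a i * T j i) = 0" "i \<le> n"
  shows "a i = 0"
  using assms
proof (induction n)
  case (Suc n)
  have "(\<Sum>i\<le>Suc n. a i * T (Suc n) i) = a (Suc n) * T (Suc n) (Suc n)"
    using Suc.prems(1)[of _ "Suc n"] by simp
  hence a: "a (Suc n) = 0"
    using Suc.prems(2)[of "Suc n"] Suc.prems(3)[of "Suc n"] by simp
  show ?case
  proof (cases "i = Suc n")
    case False
    show ?thesis
    proof (rule Suc.IH)
      show "(\<Sum>i\<le>n. a i * T j i) = 0" if "j \<le> n" for j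
        using Suc.prems(3)[of j] that a by simp
    qed (use Suc.prems False in auto)
  qed (use a in auto)
next
  case 0
  show ?case
    using 0(2)[of 0] 0(3)[of 0] 0(4) by simp
qed

lemma triangular_exists:
  fixes T :: "nat \<Rightarrow> nat \<Rightarrow> real"
  assumes "\<And>i j. i < j \<Longrightarrow> j \<le> n \<Longrightarrow> T j i = 0" "\<And>j. j \<le> n \<Longrightarrow> T j j \<noteq> 0"
  shows "\<exists>a. \<forall>j\<le>n. (\<Sum>i\<le>n. a i * T j i) = t j"
  using assms
proof (induction n arbitrary: t)
  case 0
  thus ?case
    by (intro exI[of _ "\<lambda>_. t 0 / T 0 0"]) auto
next
  case (Suc n)
  define c where "c = t (Suc n) / T (Suc n) (Suc n)"
  obtain a where a: "\<And>j. j \<le> n \<Longrightarrow> (\<Sum>i\<le>n. a i * T j i) = t j - c * T j (Suc n)"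
    using Suc.IH[of "\<lambda>j. t j - c * T j (Suc n)"] Suc.prems by (meson le_SucI)
  have "(\<Sum>i\<le>Suc n. (a(Suc n := c)) i * T j i) = t j" if "j \<le> Suc n" for j
  proof (cases "j = Suc n")
    case True
    thus ?thesis
      using Suc.prems(1)[of _ "Suc n"] Suc.prems(2)[of "Suc n"] by (simp add: c_def)
  next
    case False
    thus ?thesis
      using a[of j] that by simp
  qed
  thus ?case
    by blast
qed

section \<open>Existence, uniqueness and transform of the type II polynomials\<close>

locale jacobi_pineiro =
  fixes \<alpha> \<beta> \<gamma> :: real
  assumes \<alpha>: "\<alpha> > -1" and \<beta>: "\<beta> > -1" and \<gamma>: "\<gamma> > -1"
    and \<alpha>_neq_\<beta>: "\<alpha> \<noteq> \<beta>" and \<alpha>_\<beta>_close: "\<bar>\<alpha> - \<beta>\<bar> < 1"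
begin

text \<open>The exponents \<open>\<alpha>, \<beta>, \<alpha> + 1, \<beta> + 1, \<dots>\<close> in the order in which the orthogonality conditions
  are added along the step line.\<close>

definition r :: "nat \<Rightarrow> real" where
  "r i = (if even i then \<alpha> else \<beta>) + real (i div 2)"

lemma r_even: "r (2 * j) = \<alpha> + real j" and r_odd: "r (Suc (2 * j)) = \<beta> + real j"
  by (simp_all add: r_def)

lemma r_0 [simp]: "r 0 = \<alpha>" and r_1 [simp]: "r (Suc 0) = \<beta>"
  by (simp_all add: r_def)

lemma r_add_2: "r (Suc (Suc i)) = r i + 1"
  by (simp add: r_def)

lemma r_gt: "r i > -1"
  using \<alpha> \<beta> by (simp add: r_def add_strict_increasing2 less_le_trans)

text \<open>For indices of different parity, equality would make the distance of \<alpha> and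
  \<beta> an integer. Being less than one it would be zero, contrary to \<alpha> \<noteq>
  \<beta>.\<close>

lemma inj_r: "inj r"
proof (rule injI)
  fix i j assume eq: "r i = r j"
  show "i = j"
  proof (cases "even i \<longleftrightarrow> even j")
    case True
    thus ?thesis
      using eq by (auto simp: r_def elim!: evenE oddE)
  next
    case False
    hence "\<bar>\<alpha> - \<beta>\<bar> = real_of_int \<bar>int (i div 2) - int (j div 2)\<bar>"
      using eq by (auto simp: r_def)
    hence "\<bar>int (i div 2) - int (j div 2)\<bar> = 0"
      using \<alpha>_\<beta>_close by linarith
    thus ?thesis
      using \<open>\<bar>\<alpha> - \<beta>\<bar> = _\<close> \<alpha>_neq_\<beta> by simp
  qed
qed

lemma r_eq_iff [simp]: "r i = r j \<longleftrightarrow> i = j"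
  using inj_r by (auto dest: injD)

abbreviation \<Phi> :: "real poly \<Rightarrow> real \<Rightarrow> real" where
  "\<Phi> \<equiv> mellin \<gamma>"

lemma all_r_less_iff:
  "(\<forall>i<k. P (r i)) \<longleftrightarrow> (\<forall>j<(k + 1) div 2. P (\<alpha> + real j)) \<and> (\<forall>j<k div 2. P (\<beta> + real j))"
proof safe
  fix j assume *: "\<forall>i<k. P (r i)"
  show "P (\<alpha> + real j)" if "j < (k + 1) div 2"
    using *[rule_format, of "2 * j"] that by (simp add: r_even)
  show "P (\<beta> + real j)" if "j < k div 2"
    using *[rule_format, of "Suc (2 * j)"] that by (simp add: r_odd)
next
  fix i assume *: "\<forall>j<(k + 1) div 2. P (\<alpha> + real j)" "\<forall>j<k div 2. P (\<beta> + real j)" "i < k"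
  thus "P (r i)"
    by (cases "even i") (auto simp: r_even r_odd elim!: evenE oddE)
qed

lemma is_JP_typeII_iff:
  "is_JP_typeII \<alpha> \<beta> \<gamma> ((k + 1) div 2) (k div 2) p \<longleftrightarrow>
     degree p = k \<and> lead_coeff p = 1 \<and> (\<forall>i<k. \<Phi> p (r i) = 0)"
proof -
  have "(k + 1) div 2 + k div 2 = k"
    by presburger
  moreover have "\<alpha> + real j > -1" "\<beta> + real j > -1" for j
    using \<alpha> \<beta> by auto
  ultimately show ?thesis
    unfolding is_JP_typeII_def all_r_less_iff[of k "\<lambda>s. \<Phi> p s = 0"] by (simp add: has_integral_mellin_iff[OF \<gamma>])
qed

text \<open>The value of \<open>B k\<close> at 1, as \<open>poly_B_1\<close> will show. It is the
  factor in front of the node polynomial that makes the type II polynomial monic.\<close>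

definition type_II_at_1 :: "nat \<Rightarrow> real" where
  "type_II_at_1 k = (\<Prod>i<k. \<gamma> + 1 + real i) / (\<Prod>i<k. real k + \<gamma> + 1 + r i)"

lemma type_II_at_1_pos: "type_II_at_1 k > 0"
proof -
  have "\<gamma> + 1 + real i > 0" for i
    using \<gamma> by simp
  moreover have "real k + \<gamma> + 1 + r i > 0" if "i < k" for i
    using \<gamma> r_gt[of i] that by linarith
  ultimately show ?thesis
    unfolding type_II_at_1_def by (auto intro!: divide_pos_pos prod_pos)
qed

lemma exists_type_II:
  "\<exists>p. degree p = k \<and> lead_coeff p = 1 \<and>
       mellin_poly \<gamma> k p = smult (type_II_at_1 k) (node_poly r k)"
proof -
  define c where "c = type_II_at_1 k"
  obtain p where p: "degree p \<le> k" "mellin_poly \<gamma> k p = smult c (node_poly r k)"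
    using mellin_poly_surj[OF \<gamma>, of "smult c (node_poly r k)" k]
    by (metis degree_node_poly degree_smult_le)
  have neg: "(\<Prod>i<k. - f i) = (-1) ^ k * (\<Prod>i<k. f i :: real)" for f
    by (induction k) auto
  \<comment> \<open>Evaluation at s = -(k + \<gamma> + 1) relates the leading coefficient to the
    scaling factor.\<close>
  have "coeff p k * (\<Prod>i<k. - (\<gamma> + 1 + real i)) = c * (\<Prod>i<k. - (real k + \<gamma> + 1 + r i))"
    using poly_mellin_poly_lead[of \<gamma> k p] unfolding p(2)
    by (simp add: poly_node_poly algebra_simps)
  hence "coeff p k * (\<Prod>i<k. \<gamma> + 1 + real i) = c * (\<Prod>i<k. real k + \<gamma> + 1 + r i)"
    unfolding neg by simp
  moreover have "(\<Prod>i<k. \<gamma> + 1 + real i) > 0"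
    using \<gamma> by (intro prod_pos) auto
  moreover have "(\<Prod>i<k. real k + \<gamma> + 1 + r i) \<noteq> 0"
    using type_II_at_1_pos[of k] unfolding type_II_at_1_def by fastforce
  ultimately have "coeff p k = 1"
    by (simp add: c_def type_II_at_1_def del: prod_zero_iff)
  thus ?thesis
    using p unfolding c_def by (metis le_antisym le_degree zero_neq_one)
qed

text \<open>The difference of two candidates has degree below \<open>k\<close>, so its transform has
  degree below \<open>k\<close> as well, but it vanishes at the \<open>k\<close> distinct points
  \<open>r i\<close>.\<close>

lemma type_II_unique:
  assumes "degree p = k" "lead_coeff p = 1" "\<forall>i<k. \<Phi> p (r i) = 0"
    and "degree q = k" "lead_coeff q = 1" "\<forall>i<k. \<Phi> q (r i) = 0"
  shows "p = q"
proof (cases k)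
  case 0
  thus ?thesis
    using assms by (metis degree_eq_zeroE coeff_pCons_0 degree_pCons_0)
next
  case (Suc N)
  define d where "d = p - q"
  have "degree d \<le> N"
  proof (rule degree_le, intro allI impI)
    fix i assume "i > N"
    thus "coeff d i = 0"
      using assms Suc by (cases "i = k") (auto simp: d_def coeff_eq_0)
  qed
  have "\<Phi> d (r i) = 0" if "i < k" for i
    using assms that r_gt[of i] mellin_add[OF \<gamma>, of "r i" d q] by (simp add: d_def)
  hence "poly (mellin_poly \<gamma> N d) x = 0" if "x \<in> r ` {..<k}" for x
    using that mellin_eq_0_iff[OF \<gamma> r_gt \<open>degree d \<le> N\<close>] by auto
  moreover have "card (r ` {..<k}) = k"
    using inj_r by (simp add: card_image inj_on_subset)
  ultimately have "mellin_poly \<gamma> N d = 0"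
    using degree_mellin_poly[of \<gamma> N d] Suc
    by (intro poly_eqI_degree[where A = "r ` {..<k}"]) auto
  hence "d = 0"
    using mellin_poly_inj[OF \<gamma>, of d N 0] \<open>degree d \<le> N\<close> by simp
  thus ?thesis
    by (simp add: d_def)
qed

abbreviation B :: "nat \<Rightarrow> real poly" where
  "B \<equiv> JP_B \<alpha> \<beta> \<gamma>"

lemma is_JP_typeII_B: "is_JP_typeII \<alpha> \<beta> \<gamma> ((k + 1) div 2) (k div 2) (B k)"
  and mellin_poly_B: "mellin_poly \<gamma> k (B k) = smult (type_II_at_1 k) (node_poly r k)"
proof -
  obtain p where p: "degree p = k" "lead_coeff p = 1"
      "mellin_poly \<gamma> k p = smult (type_II_at_1 k) (node_poly r k)"
    using exists_type_II by blast
  have "\<Phi> p (r i) = 0" if "i < k" for i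
    using that r_gt[of i] p by (subst mellin_eq_0_iff[OF \<gamma>, where N = k]) (auto simp: poly_node_poly)
  hence "is_JP_typeII \<alpha> \<beta> \<gamma> ((k + 1) div 2) (k div 2) p"
    unfolding is_JP_typeII_iff using p by blast
  moreover from this have "q = p" if "is_JP_typeII \<alpha> \<beta> \<gamma> ((k + 1) div 2) (k div 2) q" for q
    using that type_II_unique[of q k p] unfolding is_JP_typeII_iff by blast
  ultimately have "B k = p"
    unfolding JP_B_def JP_typeII_def by (rule the_equality)
  thus "is_JP_typeII \<alpha> \<beta> \<gamma> ((k + 1) div 2) (k div 2) (B k)"
    "mellin_poly \<gamma> k (B k) = smult (type_II_at_1 k) (node_poly r k)"
    using p \<open>is_JP_typeII _ _ _ _ _ p\<close> by auto
qed

lemma degree_B [simp]: "degree (B k) = k" and coeff_B [simp]: "coeff (B k) k = 1"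
  using is_JP_typeII_B[of k] unfolding is_JP_typeII_iff by auto

lemma B_0: "B 0 = 1"
  using degree_B[of 0] coeff_B[of 0] by (metis degree_eq_zeroE coeff_pCons_0 one_pCons)

lemma poly_B_1: "poly (B k) 1 = type_II_at_1 k"
  using coeff_mellin_poly'[of "B k" k \<gamma>] by (simp add: mellin_poly_B)

lemma mellin_B_eq_0: "i < j \<Longrightarrow> \<Phi> (B j) (r i) = 0"
  using is_JP_typeII_B[of j] unfolding is_JP_typeII_iff by blast

lemma mellin_B_neq_0: "\<Phi> (B j) (r j) \<noteq> 0"
  using r_gt[of j] type_II_at_1_pos[of j]
  by (subst mellin_eq_0_iff[OF \<gamma>, where N = j]) (auto simp: mellin_poly_B poly_node_poly)

lemma JP_J_eqI:
  assumes "finite {l. c l \<noteq> 0}" "[:0, 1:] * B k = (\<Sum>l | c l \<noteq> 0. smult (c l) (B l))"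
  shows "JP_J \<alpha> \<beta> \<gamma> k = c"
  unfolding JP_J_def
proof (rule the_equality)
  fix d assume "finite {l. d l \<noteq> 0} \<and> [:0, 1:] * B k = (\<Sum>l | d l \<noteq> 0. smult (d l) (B l))"
  thus "d = c"
    using assms finite_expansion_unique[of B d c] by auto
qed (use assms in auto)

end

section \<open>The recurrence matrix\<close>

text \<open>In the application \<open>a\<close>, \<open>b\<close> are \<alpha>, \<beta>, the next
  three arguments are \<open>r (k - 2)\<close>, \<open>r (k - 1)\<close>, \<open>r k\<close>, and
  \<open>z\<close> is \<gamma> + k + 2 or one less.\<close>

definition up_coeff :: "real \<Rightarrow> real \<Rightarrow> real \<Rightarrow> real \<Rightarrow> real \<Rightarrow> real \<Rightarrow> real" where
  "up_coeff a b \<rho> \<sigma> \<omega> z = ((z - 1) * (z - 1 + a) * (z - 1 + b)) / ((z + \<rho>) * (z + \<sigma>) * (z + \<omega>))"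

definition down_coeff :: "real \<Rightarrow> real \<Rightarrow> real \<Rightarrow> real \<Rightarrow> real" where
  "down_coeff a b z s = ((s + 1) * (s + 1 - a) * (s + 1 - b)) / ((s + z) * (s + z - 1) * (s + z - 2))"

text \<open>The coefficients are found by evaluating at \<open>s = \<rho>, \<sigma>, -z, 1 - z\<close>, where all but one or two terms
  of the right-hand side vanish.\<close>

lemma cubic_interpolation:
  assumes nz: "\<rho> \<noteq> \<sigma>" "\<rho> + z \<noteq> 0" "\<sigma> + z \<noteq> 0" "\<omega> + z \<noteq> 0"
    "\<rho> + z - 1 \<noteq> 0" "\<sigma> + z - 1 \<noteq> 0" "\<omega> + z - 1 \<noteq> 0" "\<rho> + z - 2 \<noteq> 0" "\<sigma> + z - 2 \<noteq> 0"
  shows "(s + 1) * (s + 1 - a) * (s + 1 - b) =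
    up_coeff a b \<rho> \<sigma> \<omega> z * ((s - \<rho>) * (s - \<sigma>) * (s - \<omega>)) +
    (z - 1 + \<omega>) * (up_coeff a b \<rho> \<sigma> \<omega> z - up_coeff a b \<rho> \<sigma> \<omega> (z - 1)) * ((s + z) * (s - \<rho>) * (s - \<sigma>)) +
    (\<sigma> + z - 2) * ((down_coeff a b z \<sigma> - down_coeff a b z \<rho>) / (\<sigma> - \<rho>)) * ((s + z) * (s + z - 1) * (s - \<rho>)) +
    down_coeff a b z \<rho> * ((s + z) * (s + z - 1) * (s + z - 2))"
proof -
  define u0 where "u0 = up_coeff a b \<rho> \<sigma> \<omega> z"
  define u1 where "u1 = up_coeff a b \<rho> \<sigma> \<omega> (z - 1)"
  define d0 where "d0 = down_coeff a b z \<rho>"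
  define d1 where "d1 = down_coeff a b z \<sigma>"
  define c where "c = (\<sigma> + z - 2) * ((d1 - d0) / (\<sigma> - \<rho>))"
  have u0: "u0 * ((z + \<rho>) * (z + \<sigma>) * (z + \<omega>)) = (z - 1) * (z - 1 + a) * (z - 1 + b)"
    using nz by (simp add: u0_def up_coeff_def add.commute)
  have u1: "u1 * ((z - 1 + \<rho>) * (z - 1 + \<sigma>) * (z - 1 + \<omega>)) = (z - 2) * (z - 2 + a) * (z - 2 + b)"
  proof -
    have "z - 1 + \<rho> \<noteq> 0" "z - 1 + \<sigma> \<noteq> 0" "z - 1 + \<omega> \<noteq> 0"
      using nz by (simp_all add: algebra_simps)
    thus ?thesis
      by (simp add: u1_def up_coeff_def)
  qed
  have d0: "d0 * ((\<rho> + z) * (\<rho> + z - 1) * (\<rho> + z - 2)) = (\<rho> + 1) * (\<rho> + 1 - a) * (\<rho> + 1 - b)"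
    using nz by (simp add: d0_def down_coeff_def)
  have d1: "d1 * ((\<sigma> + z) * (\<sigma> + z - 1) * (\<sigma> + z - 2)) = (\<sigma> + 1) * (\<sigma> + 1 - a) * (\<sigma> + 1 - b)"
    using nz by (simp add: d1_def down_coeff_def)
  have c: "c * (\<sigma> - \<rho>) = (\<sigma> + z - 2) * (d1 - d0)"
    using nz by (simp add: c_def)
  define L where "L = [:1, 1:] * [:1 - a, 1:] * [:1 - b, 1:]"
  define R where "R = smult u0 ([:-\<rho>, 1:] * [:-\<sigma>, 1:] * [:-\<omega>, 1:]) +
    smult ((z - 1 + \<omega>) * (u0 - u1)) ([:z, 1:] * [:-\<rho>, 1:] * [:-\<sigma>, 1:]) +
    smult c ([:z, 1:] * [:z - 1, 1:] * [:-\<rho>, 1:]) +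
    smult d0 ([:z, 1:] * [:z - 1, 1:] * [:z - 2, 1:])"
  have polyR: "poly R s = u0 * ((s - \<rho>) * (s - \<sigma>) * (s - \<omega>)) +
    (z - 1 + \<omega>) * (u0 - u1) * ((s + z) * (s - \<rho>) * (s - \<sigma>)) +
    c * ((s + z) * (s + z - 1) * (s - \<rho>)) +
    d0 * ((s + z) * (s + z - 1) * (s + z - 2))" for s
    by (simp add: R_def algebra_simps)
  have polyL: "poly L s = (s + 1) * (s + 1 - a) * (s + 1 - b)" for s
    by (simp add: L_def algebra_simps)
  have "L = R"
  proof (rule poly_eqI_degree)
    fix x assume "x \<in> {\<rho>, \<sigma>, -z, 1 - z}"
    then consider "x = \<rho>" | "x = \<sigma>" | "x = -z" | "x = 1 - z"
      by blast
    thus "poly L x = poly R x"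
    proof cases
      case 1
      thus ?thesis
        unfolding polyR polyL using d0 by simp
    next
      case 2
      have "(\<sigma> + 1) * (\<sigma> + 1 - a) * (\<sigma> + 1 - b) = (\<sigma> + z) * (\<sigma> + z - 1) * (c * (\<sigma> - \<rho>)) +
              d0 * ((\<sigma> + z) * (\<sigma> + z - 1) * (\<sigma> + z - 2))"
        unfolding c d1 [symmetric] by (simp add: algebra_simps)
      thus ?thesis
        unfolding polyR polyL 2 by (simp add: algebra_simps)
    next
      case 3
      have "poly R x = - (u0 * ((z + \<rho>) * (z + \<sigma>) * (z + \<omega>)))"
        unfolding polyR 3 by (simp add: algebra_simps)
      also have "\<dots> = poly L x"
        unfolding u0 polyL 3 by (simp add: algebra_simps)
      finally show ?thesis ..
    next
      case 4
      \<comment> \<open>The two contributions of \<open>u0\<close> cancel here. This is why the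
        second coefficient is a difference of values of \<open>up_coeff\<close>, whose sign
        monotonicity will decide.\<close>
      have "poly R x = - (u1 * ((z - 1 + \<rho>) * (z - 1 + \<sigma>) * (z - 1 + \<omega>)))"
        unfolding polyR 4 by (simp add: algebra_simps)
      also have "\<dots> = poly L x"
        unfolding u1 polyL 4 by (simp add: algebra_simps)
      finally show ?thesis ..
    qed
  next
    have "distinct [\<rho>, \<sigma>, -z, 1 - z]"
      using nz by auto
    hence card: "card {\<rho>, \<sigma>, -z, 1 - z} = 4"
      using distinct_card by force
    have "degree L \<le> 3"
      unfolding L_def by (intro degree_le) (auto simp: coeff_pCons split: nat.splits)
    thus "degree L < card {\<rho>, \<sigma>, -z, 1 - z}"
      using card by simp
    have "degree R \<le> 3"
      unfolding R_def by (intro degree_le) (auto simp: coeff_pCons split: nat.splits)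
    thus "degree R < card {\<rho>, \<sigma>, -z, 1 - z}"
      using card by simp
  qed
  hence "poly L s = poly R s"
    by simp
  thus ?thesis
    unfolding polyL polyR u0_def u1_def d0_def c_def d1_def .
qed

section \<open>Nonnegativity of the recurrence coefficients\<close>

lemma frac_mono:
  fixes s t :: real
  assumes "s \<le> t" "e \<le> d" "s + d > 0"
  shows "(s + e) / (s + d) \<le> (t + e) / (t + d)"
proof -
  have "(s + e) * (t + d) - (t + e) * (s + d) = (e - d) * (t - s)"
    by algebra
  also have "\<dots> \<le> 0"
    using assms by (intro mult_nonpos_nonneg) auto
  finally show ?thesis
    using assms by (simp add: divide_simps)
qed

lemma frac3_mono:
  fixes s t :: real
  assumes "s \<le> t" "e1 \<le> d1" "e2 \<le> d2" "e3 \<le> d3" "s + d1 > 0" "s + d2 > 0" "s + d3 > 0"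
    and "s + e1 \<ge> 0" "s + e2 \<ge> 0" "s + e3 \<ge> 0"
  shows "((s + e1) * (s + e2) * (s + e3)) / ((s + d1) * (s + d2) * (s + d3)) \<le>
         ((t + e1) * (t + e2) * (t + e3)) / ((t + d1) * (t + d2) * (t + d3))"
proof -
  have "(s + e1) / (s + d1) * ((s + e2) / (s + d2)) * ((s + e3) / (s + d3)) \<le>
        (t + e1) / (t + d1) * ((t + e2) / (t + d2)) * ((t + e3) / (t + d3))"
    using assms by (intro mult_mono frac_mono mult_nonneg_nonneg divide_nonneg_nonneg) auto
  thus ?thesis
    by simp
qed

context jacobi_pineiro
begin

text \<open>The transition probabilities \<open>P\<^sub>I\<^sub>I(k, l)\<close> for \<open>l = k + 1, k, k - 1, k - 2\<close>, where \<open>k \<ge> 2\<close>.\<close>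

definition p_up :: "nat \<Rightarrow> real" where
  "p_up k = up_coeff \<alpha> \<beta> (r (k - 2)) (r (k - 1)) (r k) (\<gamma> + real k + 2)"

definition p_diag :: "nat \<Rightarrow> real" where
  "p_diag k = (\<gamma> + real k + 1 + r k) *
     (up_coeff \<alpha> \<beta> (r (k - 2)) (r (k - 1)) (r k) (\<gamma> + real k + 2) -
      up_coeff \<alpha> \<beta> (r (k - 2)) (r (k - 1)) (r k) (\<gamma> + real k + 1))"

definition p_down1 :: "nat \<Rightarrow> real" where
  "p_down1 k = (r (k - 1) + \<gamma> + real k) *
     ((down_coeff \<alpha> \<beta> (\<gamma> + real k + 2) (r (k - 1)) - down_coeff \<alpha> \<beta> (\<gamma> + real k + 2) (r (k - 2))) /
      (r (k - 1) - r (k - 2)))"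

definition p_down2 :: "nat \<Rightarrow> real" where
  "p_down2 k = down_coeff \<alpha> \<beta> (\<gamma> + real k + 2) (r (k - 2))"

text \<open>Each \<open>r i\<close> is at least the smaller of \<alpha> and \<beta>, and these are
  less than one apart. The two quantities are numerator factors of
  \<open>down_coeff\<close>.\<close>

lemma r_close_0_1: "r i + 1 - \<alpha> > 0" "r i + 1 - \<beta> > 0"
  using \<alpha>_\<beta>_close by (auto simp: r_def)

lemma cubic_identity:
  assumes "k \<ge> 2"
  shows "(s + 1) * (s + 1 - \<alpha>) * (s + 1 - \<beta>) =
    p_up k * ((s - r (k - 2)) * (s - r (k - 1)) * (s - r k)) +
    p_diag k * ((s + (\<gamma> + real k + 2)) * (s - r (k - 2)) * (s - r (k - 1))) +
    p_down1 k * ((s + (\<gamma> + real k + 2)) * (s + (\<gamma> + real k + 1)) * (s - r (k - 2))) +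
    p_down2 k * ((s + (\<gamma> + real k + 2)) * (s + (\<gamma> + real k + 1)) * (s + (\<gamma> + real k)))"
proof -
  have "r i + (\<gamma> + real k) > 0" for i
    using r_gt[of i] \<gamma> assms by linarith
  note * = this[of "k - 2"] this[of "k - 1"] this[of k]
  have "r (k - 2) \<noteq> r (k - 1)"
    using assms by simp
  hence "(s + 1) * (s + 1 - \<alpha>) * (s + 1 - \<beta>) =
    up_coeff \<alpha> \<beta> (r (k - 2)) (r (k - 1)) (r k) (\<gamma> + real k + 2) *
      ((s - r (k - 2)) * (s - r (k - 1)) * (s - r k)) +
    ((\<gamma> + real k + 2) - 1 + r k) *
      (up_coeff \<alpha> \<beta> (r (k - 2)) (r (k - 1)) (r k) (\<gamma> + real k + 2) -
       up_coeff \<alpha> \<beta> (r (k - 2)) (r (k - 1)) (r k) ((\<gamma> + real k + 2) - 1)) *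
      ((s + (\<gamma> + real k + 2)) * (s - r (k - 2)) * (s - r (k - 1))) +
    (r (k - 1) + (\<gamma> + real k + 2) - 2) *
      ((down_coeff \<alpha> \<beta> (\<gamma> + real k + 2) (r (k - 1)) - down_coeff \<alpha> \<beta> (\<gamma> + real k + 2) (r (k - 2))) /
       (r (k - 1) - r (k - 2))) *
      ((s + (\<gamma> + real k + 2)) * (s + (\<gamma> + real k + 2) - 1) * (s - r (k - 2))) +
    down_coeff \<alpha> \<beta> (\<gamma> + real k + 2) (r (k - 2)) *
      ((s + (\<gamma> + real k + 2)) * (s + (\<gamma> + real k + 2) - 1) * (s + (\<gamma> + real k + 2) - 2))"
    by (rule cubic_interpolation) (use * in auto)
  moreover have "(\<gamma> + real k + 2) - 1 = \<gamma> + real k + 1" "(\<gamma> + real k + 2) - 1 + r k = \<gamma> + real k + 1 + r k"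
    "r (k - 1) + (\<gamma> + real k + 2) - 2 = r (k - 1) + \<gamma> + real k"
    "s + (\<gamma> + real k + 2) - 1 = s + (\<gamma> + real k + 1)" "s + (\<gamma> + real k + 2) - 2 = s + (\<gamma> + real k)"
    by simp_all
  ultimately show ?thesis
    unfolding p_up_def p_diag_def p_down1_def p_down2_def by simp
qed

lemma p_up_pos: "k \<ge> 2 \<Longrightarrow> p_up k > 0"
proof -
  assume k: "k \<ge> 2"
  have "\<gamma> + real k + 2 + r i > 0" for i
    using r_gt[of i] \<gamma> k by linarith
  thus ?thesis
    unfolding p_up_def up_coeff_def using k \<alpha> \<beta> \<gamma>
    by (intro divide_pos_pos mult_pos_pos) auto
qed

lemma p_down2_nonneg: "k \<ge> 2 \<Longrightarrow> p_down2 k \<ge> 0"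
proof -
  assume k: "k \<ge> 2"
  have "r i + 1 > 0" "r i + \<gamma> + real k > 0" for i
    using r_gt[of i] \<gamma> k by linarith+
  note * = this[of "k - 2"]
  show ?thesis
    unfolding p_down2_def down_coeff_def using * r_close_0_1[of "k - 2"]
    by (intro divide_nonneg_nonneg mult_nonneg_nonneg) auto
qed

text \<open>The coefficient is a positive multiple of the increment of \<open>up_coeff\<close> over
  a unit step of its last argument, and \<open>up_coeff\<close> is increasing there as a product of
  three increasing quotients.\<close>

lemma p_diag_nonneg:
  assumes k: "k \<ge> 2"
  shows "p_diag k \<ge> 0"
proof -
  define z where "z = \<gamma> + real k + 1"
  have z: "z > 2" "z + \<alpha> > 1" "z + \<beta> > 1"
    using \<alpha> \<beta> \<gamma> k by (auto simp: z_def)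
  have "z + r i > 0" for i
    using r_gt[of i] z by linarith
  note pos = this[of "k - 2"] this[of "k - 1"] this[of k]
  \<comment> \<open>The parity of \<open>k\<close> decides which of \<alpha> - 1 and \<beta> - 1 is
    paired with \<open>r (k - 2)\<close>, so that each numerator shift is at most the corresponding
    denominator shift.\<close>
  have "up_coeff \<alpha> \<beta> (r (k - 2)) (r (k - 1)) (r k) z \<le> up_coeff \<alpha> \<beta> (r (k - 2)) (r (k - 1)) (r k) (z + 1)"
  proof (cases "even k")
    case True
    then obtain n where n: "k = 2 * n" by (elim evenE)
    with k obtain m where m: "n = Suc m" by (cases n) auto
    have r: "r (k - 2) = \<alpha> + real m" "r (k - 1) = \<beta> + real m"
      using r_even[of m] r_odd[of m] by (simp_all add: n m)
    have up: "up_coeff \<alpha> \<beta> (r (k - 2)) (r (k - 1)) (r k) x =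
        ((x + (\<alpha> - 1)) * (x + (\<beta> - 1)) * (x + (- 1))) / ((x + r (k - 2)) * (x + r (k - 1)) * (x + r k))" for x
      by (simp add: up_coeff_def algebra_simps)
    have "((z + (\<alpha> - 1)) * (z + (\<beta> - 1)) * (z + (- 1))) / ((z + r (k - 2)) * (z + r (k - 1)) * (z + r k)) \<le>
      ((z + 1 + (\<alpha> - 1)) * (z + 1 + (\<beta> - 1)) * (z + 1 + (- 1))) / ((z + 1 + r (k - 2)) * (z + 1 + r (k - 1)) * (z + 1 + r k))"
      by (rule frac3_mono) (use z pos r r_gt[of k] in auto)
    thus ?thesis
      unfolding up .
  next
    case False
    then obtain n where n: "k = Suc (2 * n)" by (auto elim: oddE)
    with k obtain m where m: "n = Suc m" by (cases n) auto
    have r: "r (k - 2) = \<beta> + real m" "r (k - 1) = \<alpha> + real n"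
      using r_odd[of m] r_even[of n] by (simp_all add: n m)
    have up: "up_coeff \<alpha> \<beta> (r (k - 2)) (r (k - 1)) (r k) x =
        ((x + (\<beta> - 1)) * (x + (\<alpha> - 1)) * (x + (- 1))) / ((x + r (k - 2)) * (x + r (k - 1)) * (x + r k))" for x
      by (simp add: up_coeff_def algebra_simps)
    have "((z + (\<beta> - 1)) * (z + (\<alpha> - 1)) * (z + (- 1))) / ((z + r (k - 2)) * (z + r (k - 1)) * (z + r k)) \<le>
      ((z + 1 + (\<beta> - 1)) * (z + 1 + (\<alpha> - 1)) * (z + 1 + (- 1))) / ((z + 1 + r (k - 2)) * (z + 1 + r (k - 1)) * (z + 1 + r k))"
      by (rule frac3_mono) (use z pos r r_gt[of k] in auto)
    thus ?thesis
      unfolding up .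
  qed
  moreover have "z + 1 = \<gamma> + real k + 2"
    by (simp add: z_def)
  ultimately show ?thesis
    using pos unfolding p_diag_def by (intro mult_nonneg_nonneg) (simp_all add: z_def add_ac)
qed

text \<open>The coefficient is a positive multiple of a difference quotient of the increasing
  function \<open>down_coeff\<close>, hence nonnegative whichever of the two nodes is
  larger.\<close>

lemma p_down1_nonneg:
  assumes k: "k \<ge> 2"
  shows "p_down1 k \<ge> 0"
proof -
  define z where "z = \<gamma> + real k + 2"
  have z: "z > 3"
    using \<gamma> k by (auto simp: z_def)
  have mono: "down_coeff \<alpha> \<beta> z (r i) \<le> down_coeff \<alpha> \<beta> z (r j)" if "r i \<le> r j" for i j
  proof -
    have "((r i + 1) * (r i + (1 - \<alpha>)) * (r i + (1 - \<beta>))) / ((r i + (z - 2)) * (r i + (z - 1)) * (r i + z)) \<le>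
          ((r j + 1) * (r j + (1 - \<alpha>)) * (r j + (1 - \<beta>))) / ((r j + (z - 2)) * (r j + (z - 1)) * (r j + z))"
      by (rule frac3_mono)
         (use that z \<alpha> \<beta> r_gt[of i] r_close_0_1[of i] in auto)
    thus ?thesis
      by (simp add: down_coeff_def algebra_simps)
  qed
  have "(down_coeff \<alpha> \<beta> z (r (k - 1)) - down_coeff \<alpha> \<beta> z (r (k - 2))) / (r (k - 1) - r (k - 2)) \<ge> 0"
    using mono[of "k - 1" "k - 2"] mono[of "k - 2" "k - 1"] linear[of "r (k - 1)" "r (k - 2)"]
    by (auto simp: zero_le_divide_iff)
  moreover have "r (k - 1) + \<gamma> + real k > 0"
    using r_gt[of "k - 1"] \<gamma> k by linarith
  ultimately show ?thesis
    unfolding p_down1_def z_def by (intro mult_nonneg_nonneg) simp_all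
qed

end

lemma LIMSEQ_even_odd:
  fixes f :: "nat \<Rightarrow> 'a::topological_space"
  assumes "(\<lambda>n. f (2 * n)) \<longlonglongrightarrow> L" "(\<lambda>n. f (Suc (2 * n))) \<longlonglongrightarrow> L"
  shows "f \<longlonglongrightarrow> L"
proof (rule topological_tendstoI)
  fix S assume "open S" "L \<in> S"
  hence "\<forall>\<^sub>F n in sequentially. f (2 * n) \<in> S \<and> f (Suc (2 * n)) \<in> S"
    using assms by (intro eventually_conj topological_tendstoD)
  then obtain N where N: "\<And>n. n \<ge> N \<Longrightarrow> f (2 * n) \<in> S \<and> f (Suc (2 * n)) \<in> S"
    unfolding eventually_sequentially by blast
  have "f n \<in> S" if "n \<ge> 2 * N" for n
    using that N by (cases "even n") (auto elim!: evenE oddE)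
  thus "\<forall>\<^sub>F n in sequentially. f n \<in> S"
    unfolding eventually_sequentially by blast
qed

section \<open>Identification of the type II matrix and its limits\<close>

context jacobi_pineiro
begin

lemma JP_P_II_altdef:
  "JP_P_II \<alpha> \<beta> \<gamma> k l = type_II_at_1 l / type_II_at_1 k * JP_J \<alpha> \<beta> \<gamma> k l"
  by (simp add: JP_P_II_def poly_B_1)

text \<open>Different \<open>B l\<close> become comparable once their transforms refer to a common
  degree bound; raising the bound adds one linear factor at a time.\<close>

lemma poly_mellin_poly_B:
  assumes "l \<le> N"
  shows "poly (mellin_poly \<gamma> N (B l)) s =
           type_II_at_1 l * ((\<Prod>i=l..<N. s + \<gamma> + real i + 2) * poly (node_poly r l) s)"
  using assms
proof (induction rule: dec_induct)
  case (step N)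
  have "poly (mellin_poly \<gamma> (Suc N) (B l)) s = (s + \<gamma> + real N + 2) * poly (mellin_poly \<gamma> N (B l)) s"
    using step.hyps by (subst mellin_poly_extend) (simp_all add: algebra_simps)
  thus ?case
    using step by (simp add: prod.atLeastLessThan_Suc mult_ac)
qed (simp add: mellin_poly_B)

text \<open>\<open>mellin_poly\<close> is injective, so an identity between transforms yields the
  expansion of x \<open>B k\<close>. Each transform carries the factor
  \<open>type_II_at_1 l\<close>, and scaling it out of \<open>JP_J\<close> is exactly the
  normalisation of \<open>JP_P_II\<close>.\<close>

lemma step_line_row:
  assumes w: "\<And>l. l > k + 1 \<Longrightarrow> w l = 0"
    and id: "\<And>s. (s + 1) * poly (node_poly r k) (s + 1) =
       (\<Sum>l\<le>k+1. w l * ((\<Prod>i=l..<k+1. s + \<gamma> + real i + 2) * poly (node_poly r l) s))"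
  shows "[:0, 1:] * B k = (\<Sum>l\<le>k+1. smult (JP_J \<alpha> \<beta> \<gamma> k l) (B l))"
    and "JP_P_II \<alpha> \<beta> \<gamma> k = w"
proof -
  define c where "c = (\<lambda>l. type_II_at_1 k / type_II_at_1 l * w l)"
  have c_nz: "type_II_at_1 l \<noteq> 0" for l
    using type_II_at_1_pos[of l] by simp
  have sum: "mellin_poly \<gamma> (k + 1) (\<Sum>l\<in>A. smult (c l) (B l)) =
               (\<Sum>l\<in>A. smult (c l) (mellin_poly \<gamma> (k + 1) (B l)))" for A
    by (induction A rule: infinite_finite_induct) (simp_all add: mellin_poly_add mellin_poly_smult del: mellin_poly.simps(2))
  have eq: "mellin_poly \<gamma> (k + 1) ([:0, 1:] * B k) = mellin_poly \<gamma> (k + 1) (\<Sum>l\<le>k+1. smult (c l) (B l))"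
  proof (subst poly_eq_poly_eq_iff [symmetric], rule ext)
    fix s
    have "poly (mellin_poly \<gamma> (k + 1) ([:0, 1:] * B k)) s =
            type_II_at_1 k * ((s + 1) * poly (node_poly r k) (s + 1))"
      using mellin_poly_pCons[of \<gamma> k "B k"]
      by (simp add: poly_pcompose mellin_poly_B algebra_simps del: mellin_poly.simps(2))
    also have "\<dots> = (\<Sum>l\<le>k+1. type_II_at_1 k * (w l *
        ((\<Prod>i=l..<k+1. s + \<gamma> + real i + 2) * poly (node_poly r l) s)))"
      unfolding id sum_distrib_left ..
    also have "\<dots> = (\<Sum>l\<le>k+1. c l * poly (mellin_poly \<gamma> (k + 1) (B l)) s)"
      using c_nz by (intro sum.cong refl) (simp add: poly_mellin_poly_B c_def del: mellin_poly.simps(2) prod.op_ivl_Suc)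
    also have "\<dots> = poly (mellin_poly \<gamma> (k + 1) (\<Sum>l\<le>k+1. smult (c l) (B l))) s"
      unfolding sum by (simp add: poly_sum)
    finally show "poly (mellin_poly \<gamma> (k + 1) ([:0, 1:] * B k)) s =
                  poly (mellin_poly \<gamma> (k + 1) (\<Sum>l\<le>k+1. smult (c l) (B l))) s" .
  qed
  have deg: "degree ([:0, 1:] * B k) \<le> k + 1"
    using degree_mult_le[of "[:0, 1:]" "B k"] by simp
  have deg': "degree (\<Sum>l\<le>k+1. smult (c l) (B l)) \<le> k + 1"
    by (intro degree_sum_le) (auto intro: order.trans[OF degree_smult_le])
  have expand: "[:0, 1:] * B k = (\<Sum>l\<le>k+1. smult (c l) (B l))"
    using deg deg' eq by (rule mellin_poly_inj[OF \<gamma>])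
  have supp: "{l. c l \<noteq> 0} \<subseteq> {..k+1}"
  proof safe
    fix l assume "c l \<noteq> 0"
    thus "l \<le> k + 1"
      using w[of l] by (cases "l > k + 1") (auto simp: c_def)
  qed
  have "JP_J \<alpha> \<beta> \<gamma> k = c"
  proof (rule JP_J_eqI)
    show "[:0, 1:] * B k = (\<Sum>l | c l \<noteq> 0. smult (c l) (B l))"
      unfolding expand using supp by (intro sum.mono_neutral_right) auto
  qed (use supp finite_subset in blast)
  thus "[:0, 1:] * B k = (\<Sum>l\<le>k+1. smult (JP_J \<alpha> \<beta> \<gamma> k l) (B l))" "JP_P_II \<alpha> \<beta> \<gamma> k = w"
    using expand c_nz by (auto simp: JP_P_II_altdef c_def fun_eq_iff)
qed

text \<open>Rows 0 and 1 are treated separately because the general coefficients refer to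
  \<open>r (k - 2)\<close>.\<close>

definition row_0 :: "nat \<Rightarrow> real" where
  "row_0 l = (if l = 0 then (\<alpha> + 1) / (\<alpha> + \<gamma> + 2) else if l = 1 then (\<gamma> + 1) / (\<alpha> + \<gamma> + 2) else 0)"

definition row_1 :: "nat \<Rightarrow> real" where
  "row_1 l = (if l = 0 then (\<alpha> + 1) / ((\<alpha> + \<gamma> + 2) * (\<alpha> + \<gamma> + 3))
     else if l = 1 then
       (\<gamma> + 2 + \<beta>) * ((\<gamma> + 2) * (\<gamma> + 2 + \<alpha>) / ((\<gamma> + 3 + \<alpha>) * (\<gamma> + 3 + \<beta>)) -
         (\<gamma> + 1) * (\<gamma> + 1 + \<alpha>) / ((\<gamma> + 2 + \<alpha>) * (\<gamma> + 2 + \<beta>)))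
     else if l = 2 then (\<gamma> + 2) * (\<gamma> + 2 + \<alpha>) / ((\<gamma> + 3 + \<alpha>) * (\<gamma> + 3 + \<beta>)) else 0)"

definition row :: "nat \<Rightarrow> nat \<Rightarrow> real" where
  "row k = (if k = 0 then row_0 else if k = 1 then row_1 else
     (\<lambda>l. if l = k + 1 then p_up k else if l = k then p_diag k else if l = k - 1 then p_down1 k
          else if l = k - 2 then p_down2 k else 0))"

lemma row_eq_0: "l > k + 1 \<Longrightarrow> row k l = 0" "l + 2 < k \<Longrightarrow> row k l = 0"
  by (auto simp: row_def row_0_def row_1_def)

text \<open>As \<open>r (i + 2) = r i + 1\<close>, the shifted node polynomial of \<open>k\<close>
  is (s + 1 - \<alpha>) (s + 1 - \<beta>) times the node polynomial of \<open>k - 2\<close>. The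
  latter divides every term, and \<open>cubic_identity\<close> remains.\<close>

lemma row_identity:
  "(s + 1) * poly (node_poly r k) (s + 1) =
     (\<Sum>l\<le>k+1. row k l * ((\<Prod>i=l..<k+1. s + \<gamma> + real i + 2) * poly (node_poly r l) s))"
proof -
  consider "k = 0" | "k = 1" | n where "k = Suc (Suc n)"
    by (metis One_nat_def not0_implies_Suc)
  thus ?thesis
  proof cases
    case 1
    have "\<alpha> + \<gamma> + 2 > 0"
      using \<alpha> \<gamma> by simp
    thus ?thesis
      unfolding 1 by (simp add: row_def row_0_def poly_node_poly divide_simps) (simp add: algebra_simps)
  next
    case 2
    have "\<alpha> + \<gamma> + 2 \<noteq> 0" "\<alpha> + \<gamma> + 3 \<noteq> 0" "\<gamma> + 3 + \<alpha> \<noteq> 0" "\<gamma> + 3 + \<beta> \<noteq> 0" "\<gamma> + 2 + \<alpha> \<noteq> 0" "\<gamma> + 2 + \<beta> \<noteq> 0"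
      using \<alpha> \<beta> \<gamma> by auto
    hence "(s + 1) * (s + 1 - \<alpha>) = row_1 0 * ((s + \<gamma> + 2) * (s + \<gamma> + 3)) +
            row_1 1 * ((s + \<gamma> + 3) * (s - \<alpha>)) + row_1 2 * ((s - \<alpha>) * (s - \<beta>))"
      by (simp add: row_1_def divide_simps) algebra
    moreover have "{0..<Suc (Suc 0)} = {0, 1}"
      by auto
    ultimately show ?thesis
      unfolding 2 by (simp add: row_def poly_node_poly numeral_2_eq_2 algebra_simps)
  next
    case (3 n)
    have "poly (node_poly r k) (s + 1) = (s + 1 - \<alpha>) * (s + 1 - \<beta>) * poly (node_poly r n) s"
      unfolding 3 by (simp add: poly_node_poly prod.lessThan_Suc_shift r_add_2 del: prod.lessThan_Suc)
    hence "(s + 1) * poly (node_poly r k) (s + 1) =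
             ((s + 1) * (s + 1 - \<alpha>) * (s + 1 - \<beta>)) * poly (node_poly r n) s"
      by simp
    also have "\<dots> = (\<Sum>l\<in>{n, n+1, n+2, n+3}.
        row k l * ((\<Prod>i=l..<k+1. s + \<gamma> + real i + 2) * poly (node_poly r l) s))"
    proof -
      have poly_Suc: "poly (node_poly r (Suc i)) s = poly (node_poly r i) s * (s - r i)" for i
        by (simp add: node_poly_Suc algebra_simps)
      have cubic: "(s + 1) * (s + 1 - \<alpha>) * (s + 1 - \<beta>) =
          p_up k * ((s - r n) * (s - r (Suc n)) * (s - r (Suc (Suc n)))) +
          p_diag k * ((s + (\<gamma> + real n + 4)) * (s - r n) * (s - r (Suc n))) +
          p_down1 k * ((s + (\<gamma> + real n + 4)) * (s + (\<gamma> + real n + 3)) * (s - r n)) +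
          p_down2 k * ((s + (\<gamma> + real n + 4)) * (s + (\<gamma> + real n + 3)) * (s + (\<gamma> + real n + 2)))"
        using cubic_identity[of k s] by (simp add: 3 add_ac)
      have rows: "row k n = p_down2 k" "row k (Suc n) = p_down1 k" "row k (Suc (Suc n)) = p_diag k"
        "row k (Suc (Suc (Suc n))) = p_up k"
        by (simp_all add: row_def 3)
      have "(\<Sum>l\<in>{n, n+1, n+2, n+3}.
          row k l * ((\<Prod>i=l..<k+1. s + \<gamma> + real i + 2) * poly (node_poly r l) s)) =
        (p_down2 k * ((s + \<gamma> + real n + 2) * (s + \<gamma> + real n + 3) * (s + \<gamma> + real n + 4)) +
         p_down1 k * ((s + \<gamma> + real n + 3) * (s + \<gamma> + real n + 4) * (s - r n)) +
         p_diag k * ((s + \<gamma> + real n + 4) * (s - r n) * (s - r (Suc n))) +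
         p_up k * ((s - r n) * (s - r (Suc n)) * (s - r (Suc (Suc n))))) * poly (node_poly r n) s"
        by (simp add: 3 numeral_3_eq_3 numeral_2_eq_2 poly_Suc rows [unfolded 3] add_ac)
           (simp add: algebra_simps)
      thus ?thesis
        unfolding cubic by (simp add: add_ac mult_ac)
    qed
    also have "\<dots> = (\<Sum>l\<le>k+1. row k l * ((\<Prod>i=l..<k+1. s + \<gamma> + real i + 2) * poly (node_poly r l) s))"
      using row_eq_0(2)[of _ k] by (intro sum.mono_neutral_left) (auto simp: 3)
    finally show ?thesis .
  qed
qed

lemma JP_P_II_eq_row: "JP_P_II \<alpha> \<beta> \<gamma> k = row k"
  and x_times_B: "[:0, 1:] * B k = (\<Sum>l\<le>k+1. smult (JP_J \<alpha> \<beta> \<gamma> k l) (B l))"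
  using step_line_row[of k "row k", OF row_eq_0(1) row_identity] by auto

lemma row_nonneg: "row k l \<ge> 0"
proof -
  consider "k = 0" | "k = 1" | "k \<ge> 2"
    by linarith
  thus ?thesis
  proof cases
    case 1
    thus ?thesis
      using \<alpha> \<gamma> by (auto simp: row_def row_0_def)
  next
    case 2
    have pos: "\<gamma> + 2 + \<alpha> > 0" "\<gamma> + 2 + \<beta> > 0" "\<gamma> + 3 + \<alpha> > 0" "\<gamma> + 3 + \<beta> > 0" "\<gamma> + 1 > 0"
      using \<alpha> \<beta> \<gamma> by auto
    have 1: "(\<gamma> + 1) / (\<gamma> + 2 + \<beta>) \<le> (\<gamma> + 2) / (\<gamma> + 3 + \<beta>)"
      using frac_mono[of "\<gamma> + 1" "\<gamma> + 2" 0 "1 + \<beta>"] \<beta> pos by (simp add: algebra_simps)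
    have "(\<gamma> + 1 + \<alpha>) / (\<gamma> + 2 + \<alpha>) \<le> (\<gamma> + 2 + \<alpha>) / (\<gamma> + 3 + \<alpha>)"
      using frac_mono[of "\<gamma> + 1" "\<gamma> + 2" \<alpha> "1 + \<alpha>"] pos by (simp add: algebra_simps)
    hence "(\<gamma> + 1) / (\<gamma> + 2 + \<beta>) * ((\<gamma> + 1 + \<alpha>) / (\<gamma> + 2 + \<alpha>)) \<le>
           (\<gamma> + 1) / (\<gamma> + 2 + \<beta>) * ((\<gamma> + 2 + \<alpha>) / (\<gamma> + 3 + \<alpha>))"
      using pos by (intro mult_left_mono) auto
    also have "\<dots> \<le> (\<gamma> + 2) / (\<gamma> + 3 + \<beta>) * ((\<gamma> + 2 + \<alpha>) / (\<gamma> + 3 + \<alpha>))"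
      using 1 pos by (intro mult_right_mono) auto
    finally have "(\<gamma> + 1) * (\<gamma> + 1 + \<alpha>) / ((\<gamma> + 2 + \<alpha>) * (\<gamma> + 2 + \<beta>)) \<le>
                  (\<gamma> + 2) * (\<gamma> + 2 + \<alpha>) / ((\<gamma> + 3 + \<alpha>) * (\<gamma> + 3 + \<beta>))"
      by (simp add: mult_ac)
    thus ?thesis
      using 2 pos \<alpha> by (auto simp: row_def row_1_def intro!: mult_nonneg_nonneg)
  next
    case 3
    thus ?thesis
      using p_up_pos[of k] p_diag_nonneg[of k] p_down1_nonneg[of k] p_down2_nonneg[of k]
      by (auto simp: row_def)
  qed
qed

lemma row_up_pos: "row k (Suc k) > 0"
proof -
  have "\<gamma> + 2 + \<alpha> > 0" "\<gamma> + 3 + \<alpha> > 0" "\<gamma> + 3 + \<beta> > 0"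
    using \<alpha> \<beta> \<gamma> by auto
  thus ?thesis
    using p_up_pos[of k] \<alpha> \<beta> \<gamma> by (auto simp: row_def row_0_def row_1_def numeral_2_eq_2 add_ac)
qed

text \<open>Evaluate the recurrence for x \<open>B k\<close> at x = 1.\<close>

lemma sum_row: "(\<Sum>l\<le>k+1. row k l) = 1"
proof -
  have "type_II_at_1 k = poly ([:0, 1:] * B k) 1"
    by (simp add: poly_B_1)
  also have "\<dots> = (\<Sum>l\<le>k+1. JP_J \<alpha> \<beta> \<gamma> k l * type_II_at_1 l)"
    unfolding x_times_B by (simp add: poly_sum poly_B_1)
  finally have "(\<Sum>l\<le>k+1. JP_J \<alpha> \<beta> \<gamma> k l * type_II_at_1 l) / type_II_at_1 k = 1"
    using type_II_at_1_pos[of k] by simp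
  moreover have "(\<Sum>l\<le>k+1. row k l) =
      (\<Sum>l\<le>k+1. JP_J \<alpha> \<beta> \<gamma> k l * type_II_at_1 l) / type_II_at_1 k"
    unfolding JP_P_II_eq_row [symmetric] JP_P_II_altdef sum_divide_distrib by (intro sum.cong) auto
  ultimately show ?thesis
    by simp
qed

lemma JP_J_nonneg: "JP_J \<alpha> \<beta> \<gamma> k l \<ge> 0"
  and JP_J_eq_0: "l > k + 1 \<or> l + 2 < k \<Longrightarrow> JP_J \<alpha> \<beta> \<gamma> k l = 0"
proof -
  have "JP_J \<alpha> \<beta> \<gamma> k l = type_II_at_1 k / type_II_at_1 l * row k l"
    using type_II_at_1_pos[of k] type_II_at_1_pos[of l]
    by (simp flip: JP_P_II_eq_row add: JP_P_II_altdef)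
  thus "JP_J \<alpha> \<beta> \<gamma> k l \<ge> 0" "l > k + 1 \<or> l + 2 < k \<Longrightarrow> JP_J \<alpha> \<beta> \<gamma> k l = 0"
    using row_nonneg[of k l] type_II_at_1_pos[of k] type_II_at_1_pos[of l] row_eq_0 by auto
qed

text \<open>Since \<open>r k\<close> grows like k/2, \<open>up_coeff\<close> behaves like (k /
  (3k/2))^3 and \<open>down_coeff\<close> like ((k/2) / (3k/2))^3. The four limits are the terms in
  the expansion of (2/3 + 1/3)^3.\<close>

lemma row_limits:
  shows "(\<lambda>k. row (k + 2) (k + 3)) \<longlonglongrightarrow> 8 / 27"
    and "(\<lambda>k. row (k + 2) (k + 2)) \<longlonglongrightarrow> 12 / 27"
    and "(\<lambda>k. row (k + 2) (k + 1)) \<longlonglongrightarrow> 6 / 27"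
    and "(\<lambda>k. row (k + 2) k) \<longlonglongrightarrow> 1 / 27"
proof -
  have r_simps: "r (2 * n) = \<alpha> + real n" "r (2 * n + 1) = \<beta> + real n" "r (2 * n + 2) = \<alpha> + real n + 1"
    "r (2 * n + 3) = \<beta> + real n + 1" for n
    by (simp_all add: r_def)
  have row: "row (k + 2) (k + 3) = up_coeff \<alpha> \<beta> (r k) (r (k + 1)) (r (k + 2)) (\<gamma> + real k + 4)"
    "row (k + 2) (k + 2) = (\<gamma> + real k + 3 + r (k + 2)) *
       (up_coeff \<alpha> \<beta> (r k) (r (k + 1)) (r (k + 2)) (\<gamma> + real k + 4) -
        up_coeff \<alpha> \<beta> (r k) (r (k + 1)) (r (k + 2)) (\<gamma> + real k + 3))"
    "row (k + 2) k = down_coeff \<alpha> \<beta> (\<gamma> + real k + 4) (r k)" for k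
    by (simp_all add: row_def p_up_def p_diag_def p_down2_def add_ac)
  have eo: "2 * n + 1 + 1 = 2 * n + 2" "2 * n + 1 + 2 = 2 * n + 3" for n :: nat
    by simp_all
  show up: "(\<lambda>k. row (k + 2) (k + 3)) \<longlonglongrightarrow> 8 / 27"
    unfolding row up_coeff_def
    by (rule LIMSEQ_even_odd; simp only: Suc_eq_plus1 eo r_simps of_nat_mult of_nat_add of_nat_numeral of_nat_1; real_asymp)
  show diag: "(\<lambda>k. row (k + 2) (k + 2)) \<longlonglongrightarrow> 12 / 27"
    unfolding row up_coeff_def
    by (rule LIMSEQ_even_odd; simp only: Suc_eq_plus1 eo r_simps of_nat_mult of_nat_add of_nat_numeral of_nat_1; real_asymp;
        simp add: field_simps)
  show down2: "(\<lambda>k. row (k + 2) k) \<longlonglongrightarrow> 1 / 27"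
    unfolding row down_coeff_def
    by (rule LIMSEQ_even_odd; simp only: Suc_eq_plus1 eo r_simps of_nat_mult of_nat_add of_nat_numeral of_nat_1; real_asymp)
  have four: "(\<Sum>l\<le>k+2+1. row (k + 2) l) = (\<Sum>l\<in>{k, k+1, k+2, k+3}. row (k + 2) l)" for k
    using row_eq_0(2)[of _ "k + 2"] by (intro sum.mono_neutral_right) auto
  \<comment> \<open>The limit of the remaining entry follows from the other three, since each row
    sums to one.\<close>
  have "row (k + 2) (k + 1) = 1 - row (k + 2) (k + 3) - row (k + 2) (k + 2) - row (k + 2) k" for k
    using sum_row[of "k + 2"] unfolding four by simp
  moreover have "(\<lambda>k. 1 - row (k + 2) (k + 3) - row (k + 2) (k + 2) - row (k + 2) k) \<longlonglongrightarrow>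
                   1 - 8 / 27 - 12 / 27 - 1 / 27"
    by (intro tendsto_intros up diag down2)
  ultimately show "(\<lambda>k. row (k + 2) (k + 1)) \<longlonglongrightarrow> 6 / 27"
    by simp
qed

end

section \<open>Type I forms\<close>

lemma sum_even_odd:
  "(\<Sum>i\<le>k. g i) = (\<Sum>j<k div 2 + 1. g (2 * j)) + (\<Sum>j<(k + 1) div 2. g (Suc (2 * j)))"
  for g :: "nat \<Rightarrow> 'a::comm_monoid_add"
proof (induction k)
  case (Suc k)
  show ?case
    using Suc by (cases "even k") (auto elim!: evenE oddE simp: ac_simps)
qed simp

lemma poly_eq_sum_less: "(\<And>j. j \<ge> n \<Longrightarrow> coeff p j = 0) \<Longrightarrow> poly p x = (\<Sum>j<n. coeff p j * x ^ j)"
  for p :: "'a::comm_semiring_1 poly"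
  unfolding poly_altdef
  by (rule sum.mono_neutral_cong) (auto simp: coeff_eq_0 not_le intro: leI)

context jacobi_pineiro
begin

text \<open>Interleaves the coefficients of the two polynomials so that entry \<open>i\<close>
  belongs to x to the power \<open>r i\<close>.\<close>

definition form_coeff :: "real poly \<times> real poly \<Rightarrow> nat \<Rightarrow> real" where
  "form_coeff A i = coeff (if even i then fst A else snd A) (i div 2)"

lemma form_coeff_inject: "form_coeff A = form_coeff A' \<Longrightarrow> A = A'"
proof (rule prod_eqI; rule poly_eqI)
  fix j assume "form_coeff A = form_coeff A'"
  hence "form_coeff A (2 * j) = form_coeff A' (2 * j)"
    "form_coeff A (Suc (2 * j)) = form_coeff A' (Suc (2 * j))"
    by simp_all
  thus "coeff (fst A) j = coeff (fst A') j" "coeff (snd A) j = coeff (snd A') j"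
    by (simp_all add: form_coeff_def)
qed

lemma form_coeff_exists:
  assumes "\<And>i. i > k \<Longrightarrow> a i = 0"
  shows "\<exists>A. form_coeff A = a"
proof (intro exI ext)
  fix i
  have "coeff (Abs_poly (\<lambda>j. a (2 * j))) = (\<lambda>j. a (2 * j))"
    "coeff (Abs_poly (\<lambda>j. a (Suc (2 * j)))) = (\<lambda>j. a (Suc (2 * j)))"
    using assms by (intro coeff_Abs_poly[where n = k]; simp)+
  thus "form_coeff (Abs_poly (\<lambda>j. a (2 * j)), Abs_poly (\<lambda>j. a (Suc (2 * j)))) i = a i"
    by (auto simp: form_coeff_def elim!: evenE oddE)
qed

lemma form_coeff_eq_0_iff:
  "(fst A = 0 \<or> degree (fst A) < k div 2 + 1) \<and> (snd A = 0 \<or> degree (snd A) < (k + 1) div 2) \<longleftrightarrow>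
     (\<forall>i>k. form_coeff A i = 0)"
proof -
  have deg: "p = 0 \<or> degree p < n \<longleftrightarrow> (\<forall>j\<ge>n. coeff p j = 0)" for p :: "real poly" and n
    by (metis coeff_eq_0 leading_coeff_0_iff less_le_trans not_le_imp_less coeff_0)
  show ?thesis
    unfolding deg
  proof safe
    fix i assume *: "\<forall>j\<ge>k div 2 + 1. coeff (fst A) j = 0" "\<forall>j\<ge>(k + 1) div 2. coeff (snd A) j = 0" "i > k"
    thus "form_coeff A i = 0"
      by (cases "even i") (auto simp: form_coeff_def elim!: evenE oddE)
  next
    fix j assume *: "\<forall>i>k. form_coeff A i = 0"
    show "coeff (fst A) j = 0" if "j \<ge> k div 2 + 1"
      using *[rule_format, of "2 * j"] that by (simp add: form_coeff_def)
    show "coeff (snd A) j = 0" if "j \<ge> (k + 1) div 2"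
      using *[rule_format, of "Suc (2 * j)"] that by (simp add: form_coeff_def)
  qed
qed

lemma JP_form_eq_sum:
  assumes "\<forall>i>k. form_coeff A i = 0" "x \<ge> 0"
  shows "JP_form \<alpha> \<beta> A x = (\<Sum>i\<le>k. form_coeff A i * x powr r i)"
proof -
  have "coeff (fst A) j = 0" if "j \<ge> k div 2 + 1" for j
    using assms(1)[rule_format, of "2 * j"] that by (simp add: form_coeff_def)
  hence "poly (fst A) x * x powr \<alpha> = (\<Sum>j<k div 2 + 1. form_coeff A (2 * j) * x powr r (2 * j))"
    using assms(2) by (subst poly_eq_sum_less)
      (auto simp: sum_distrib_right form_coeff_def r_even power_mult_powr mult.assoc)
  moreover have "coeff (snd A) j = 0" if "j \<ge> (k + 1) div 2" for j
    using assms(1)[rule_format, of "Suc (2 * j)"] that by (simp add: form_coeff_def)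
  hence "poly (snd A) x * x powr \<beta> = (\<Sum>j<(k + 1) div 2. form_coeff A (Suc (2 * j)) * x powr r (Suc (2 * j)))"
    using assms(2) by (subst poly_eq_sum_less)
      (auto simp: sum_distrib_right form_coeff_def r_odd power_mult_powr mult.assoc)
  ultimately show ?thesis
    unfolding sum_even_odd JP_form_def by simp
qed

lemma has_integral_JP_form:
  assumes "\<forall>i>k. form_coeff A i = 0"
  shows "((\<lambda>x. JP_form \<alpha> \<beta> A x * (1 - x) powr \<gamma> * x ^ j) has_integral
           (\<Sum>i\<le>k. form_coeff A i * \<Phi> (monom 1 j) (r i))) {0..1}"
proof -
  have "((\<lambda>x. \<Sum>i\<le>k. form_coeff A i * (poly (monom 1 j) x * x powr r i * (1 - x) powr \<gamma>)) has_integral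
           (\<Sum>i\<le>k. form_coeff A i * \<Phi> (monom 1 j) (r i))) {0..1}"
    by (intro has_integral_sum has_integral_mult_right has_integral_mellin \<gamma> r_gt) auto
  thus ?thesis
    by (rule has_integral_eq [rotated])
       (auto simp: JP_form_eq_sum[OF assms] sum_distrib_left sum_distrib_right poly_monom mult_ac)
qed

text \<open>The right-hand side, that the functional reads off the coefficient of x^k, does not
  mention the basis. Hence the conditions may be tested on any monic basis; this will exchange the
  monomials for the \<open>B j\<close>.\<close>

lemma dual_functional_iff:
  assumes deg: "\<And>j. degree (C j) = j" and monic: "\<And>j. coeff (C j) j = 1"
  shows "(\<forall>j\<le>k. (\<Sum>i\<le>k. a i * \<Phi> (C j) (r i)) = (if j = k then 1 else 0)) \<longleftrightarrow>
         (\<forall>p. degree p \<le> k \<longrightarrow> (\<Sum>i\<le>k. a i * \<Phi> p (r i)) = coeff p k)"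
proof (intro iffI allI impI)
  fix p :: "real poly"
  assume *: "\<forall>j\<le>k. (\<Sum>i\<le>k. a i * \<Phi> (C j) (r i)) = (if j = k then 1 else 0)" and "degree p \<le> k"
  then obtain b where b: "p = (\<Sum>j\<le>k. smult (b j) (C j))"
    using monic_basis[of C, OF deg monic] by blast
  have "(\<Sum>i\<le>k. a i * \<Phi> p (r i)) = (\<Sum>i\<le>k. \<Sum>j\<le>k. b j * (a i * \<Phi> (C j) (r i)))"
    unfolding b by (simp add: mellin_sum[OF \<gamma> r_gt] mellin_smult[OF \<gamma> r_gt] sum_distrib_left mult_ac)
  also have "\<dots> = (\<Sum>j\<le>k. b j * (\<Sum>i\<le>k. a i * \<Phi> (C j) (r i)))"
    by (subst sum.swap) (simp add: sum_distrib_left)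
  also have "\<dots> = (\<Sum>j\<le>k. if j = k then b j else 0)"
    using * by (intro sum.cong) auto
  also have "\<dots> = b k"
    by simp
  also have "b k = coeff p k"
  proof -
    have "coeff p k = (\<Sum>j\<le>k. if j = k then b j else 0)"
      unfolding b coeff_sum using deg monic by (intro sum.cong) (auto simp: coeff_eq_0)
    thus ?thesis
      by simp
  qed
  finally show "(\<Sum>i\<le>k. a i * \<Phi> p (r i)) = coeff p k" .
next
  fix j assume *: "\<forall>p. degree p \<le> k \<longrightarrow> (\<Sum>i\<le>k. a i * \<Phi> p (r i)) = coeff p k" "j \<le> k"
  thus "(\<Sum>i\<le>k. a i * \<Phi> (C j) (r i)) = (if j = k then 1 else 0)"
    using deg[of j] monic[of j] by (auto simp: coeff_eq_0)
qed

lemma is_JP_typeI_iff: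
  "is_JP_typeI \<alpha> \<beta> \<gamma> (k div 2 + 1) ((k + 1) div 2) A \<longleftrightarrow>
     (\<forall>i>k. form_coeff A i = 0) \<and>
     (\<forall>j\<le>k. (\<Sum>i\<le>k. form_coeff A i * \<Phi> (B j) (r i)) = (if j = k then 1 else 0))"
proof -
  have k: "k div 2 + 1 + (k + 1) div 2 = k + 1"
    by presburger
  have integral: "((\<lambda>x. JP_form \<alpha> \<beta> A x * (1 - x) powr \<gamma> * x ^ j) has_integral I) {0..1} \<longleftrightarrow>
      (\<Sum>i\<le>k. form_coeff A i * \<Phi> (monom 1 j) (r i)) = I" if "\<forall>i>k. form_coeff A i = 0" for j I
    using has_integral_JP_form[OF that, of j] has_integral_unique by blast
  have "is_JP_typeI \<alpha> \<beta> \<gamma> (k div 2 + 1) ((k + 1) div 2) A \<longleftrightarrow>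
     (\<forall>i>k. form_coeff A i = 0) \<and>
     (\<forall>j. j + 2 \<le> k + 1 \<longrightarrow> (\<Sum>i\<le>k. form_coeff A i * \<Phi> (monom 1 j) (r i)) = 0) \<and>
     (\<Sum>i\<le>k. form_coeff A i * \<Phi> (monom 1 k) (r i)) = 1"
    unfolding is_JP_typeI_def k form_coeff_eq_0_iff [symmetric]
    using integral[folded form_coeff_eq_0_iff] by auto
  also have "\<dots> \<longleftrightarrow> (\<forall>i>k. form_coeff A i = 0) \<and>
     (\<forall>j\<le>k. (\<Sum>i\<le>k. form_coeff A i * \<Phi> (monom 1 j) (r i)) = (if j = k then 1 else 0))"
  proof -
    have "j + 2 \<le> k + 1 \<longleftrightarrow> j < k" for j
      by auto
    thus ?thesis
      by (auto simp: le_less)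
  qed
  also have "(\<forall>j\<le>k. (\<Sum>i\<le>k. form_coeff A i * \<Phi> (monom 1 j) (r i)) = (if j = k then 1 else 0)) \<longleftrightarrow>
      (\<forall>j\<le>k. (\<Sum>i\<le>k. form_coeff A i * \<Phi> (B j) (r i)) = (if j = k then 1 else 0))"
    by (subst (1 2) dual_functional_iff) (auto simp: degree_monom_eq)
  finally show ?thesis .
qed

section \<open>Existence, uniqueness and biorthogonality of the type I forms\<close>

definition type_I_coeff :: "nat \<Rightarrow> nat \<Rightarrow> real" where
  "type_I_coeff k = form_coeff (THE A. is_JP_typeI \<alpha> \<beta> \<gamma> (k div 2 + 1) ((k + 1) div 2) A)"

text \<open>Tested against the \<open>B j\<close>, the defining system is triangular by
  \<open>mellin_B_eq_0\<close>, with nonzero diagonal by \<open>mellin_B_neq_0\<close>.\<close>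

lemma ex1_JP_typeI: "\<exists>!A. is_JP_typeI \<alpha> \<beta> \<gamma> (k div 2 + 1) ((k + 1) div 2) A"
proof (rule ex_ex1I)
  obtain a where a: "\<And>j. j \<le> k \<Longrightarrow> (\<Sum>i\<le>k. a i * \<Phi> (B j) (r i)) = (if j = k then 1 else 0)"
    using triangular_exists[of k "\<lambda>j i. \<Phi> (B j) (r i)" "\<lambda>j. if j = k then 1 else 0"]
      mellin_B_eq_0 mellin_B_neq_0 by blast
  obtain A where "form_coeff A = (\<lambda>i. if i \<le> k then a i else 0)"
    using form_coeff_exists[of k "\<lambda>i. if i \<le> k then a i else 0"] by auto
  thus "\<exists>A. is_JP_typeI \<alpha> \<beta> \<gamma> (k div 2 + 1) ((k + 1) div 2) A"
    using a unfolding is_JP_typeI_iff by (intro exI[of _ A]) simp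
next
  fix A A' assume *: "is_JP_typeI \<alpha> \<beta> \<gamma> (k div 2 + 1) ((k + 1) div 2) A"
    "is_JP_typeI \<alpha> \<beta> \<gamma> (k div 2 + 1) ((k + 1) div 2) A'"
  have "form_coeff A i = form_coeff A' i" for i
  proof (cases "i \<le> k")
    case True
    have "form_coeff A i - form_coeff A' i = 0"
    proof (rule triangular_unique[where T = "\<lambda>j i. \<Phi> (B j) (r i)" and n = k])
      show "(\<Sum>i\<le>k. (form_coeff A i - form_coeff A' i) * \<Phi> (B j) (r i)) = 0" if "j \<le> k" for j
        using * that unfolding is_JP_typeI_iff by (simp add: left_diff_distrib sum_subtractf)
    qed (use True mellin_B_eq_0 mellin_B_neq_0 in auto)
    thus ?thesis
      by simp
  qed (use * in \<open>unfold is_JP_typeI_iff, auto\<close>)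
  thus "A = A'"
    by (intro form_coeff_inject ext)
qed

lemma type_I_coeff_eq_0: "i > k \<Longrightarrow> type_I_coeff k i = 0"
  and biorthogonal: "(\<Sum>i\<le>k. type_I_coeff k i * \<Phi> (B j) (r i)) = (if j = k then 1 else 0)"
proof -
  have *: "is_JP_typeI \<alpha> \<beta> \<gamma> (k div 2 + 1) ((k + 1) div 2)
      (THE A. is_JP_typeI \<alpha> \<beta> \<gamma> (k div 2 + 1) ((k + 1) div 2) A)"
    by (rule theI'[OF ex1_JP_typeI])
  thus "i > k \<Longrightarrow> type_I_coeff k i = 0"
    unfolding is_JP_typeI_iff type_I_coeff_def by blast
  show "(\<Sum>i\<le>k. type_I_coeff k i * \<Phi> (B j) (r i)) = (if j = k then 1 else 0)"
  proof (cases "j \<le> k")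
    case True
    thus ?thesis
      using * unfolding is_JP_typeI_iff type_I_coeff_def by blast
  next
    case False
    thus ?thesis
      by (simp add: mellin_B_eq_0)
  qed
qed

lemma biorthogonal': "N \<ge> k \<Longrightarrow> (\<Sum>i\<le>N. type_I_coeff k i * \<Phi> (B j) (r i)) = (if j = k then 1 else 0)"
  unfolding biorthogonal [of k j, symmetric]
  by (rule sum.mono_neutral_right) (auto simp: type_I_coeff_eq_0)

abbreviation Q_at_1 :: "nat \<Rightarrow> real" where
  "Q_at_1 k \<equiv> JP_Q \<alpha> \<beta> \<gamma> k 1"

lemma Q_at_1_eq_sum: "N \<ge> k \<Longrightarrow> Q_at_1 k = (\<Sum>i\<le>N. type_I_coeff k i)"
proof -
  assume N: "N \<ge> k"
  have "Q_at_1 k = (\<Sum>i\<le>k. type_I_coeff k i)"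
    unfolding JP_Q_def JP_typeI_def using type_I_coeff_eq_0[of k]
    by (subst JP_form_eq_sum[where k = k]) (auto simp: type_I_coeff_def)
  also have "\<dots> = (\<Sum>i\<le>N. type_I_coeff k i)"
    using N by (intro sum.mono_neutral_left) (auto simp: type_I_coeff_eq_0)
  finally show ?thesis .
qed

section \<open>Recurrence and positivity of the type I forms at one\<close>

text \<open>The recurrence for the type I forms: both sides are combinations of \<open>x\<close> to the powers
  \<open>r 0, \<dots>, r (k + 2)\<close> with the same integrals against \<open>B 0, \<dots>, B (k + 2)\<close>.\<close>

lemma type_I_recurrence:
  assumes "i \<le> k + 2"
  shows "(if i \<ge> 2 then type_I_coeff k (i - 2) else 0) =
           (\<Sum>l\<le>k+2. JP_J \<alpha> \<beta> \<gamma> l k * type_I_coeff l i)"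
proof -
  define b where "b = (\<lambda>i. (if i \<ge> 2 then type_I_coeff k (i - 2) else 0) -
    (\<Sum>l\<le>k+2. JP_J \<alpha> \<beta> \<gamma> l k * type_I_coeff l i))"
  have "b i = 0"
  proof (rule triangular_unique[where T = "\<lambda>j i. \<Phi> (B j) (r i)" and n = "k + 2"])
    fix j assume j: "j \<le> k + 2"
    \<comment> \<open>Raising the index by two raises the exponent by one, so the shifted
      coefficients belong to x times the form. The factor x is moved onto \<open>B j\<close>, where
      the type II recurrence applies.\<close>
    have "(\<Sum>i\<le>k+2. (if i \<ge> 2 then type_I_coeff k (i - 2) else 0) * \<Phi> (B j) (r i)) =
          (\<Sum>i\<le>k. type_I_coeff k i * \<Phi> ([:0, 1:] * B j) (r i))"
      unfolding add_2_eq_Suc' sum.atMost_Suc_shift by (simp add: r_add_2 mellin_pCons[OF \<gamma>])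
    also have "\<dots> = (\<Sum>i\<le>k. \<Sum>l\<le>j+1. JP_J \<alpha> \<beta> \<gamma> j l * (type_I_coeff k i * \<Phi> (B l) (r i)))"
      unfolding x_times_B by (simp add: mellin_sum[OF \<gamma> r_gt] mellin_add[OF \<gamma> r_gt] mellin_smult[OF \<gamma> r_gt] sum_distrib_left algebra_simps)
    also have "\<dots> = (\<Sum>l\<le>j+1. JP_J \<alpha> \<beta> \<gamma> j l * (\<Sum>i\<le>k. type_I_coeff k i * \<Phi> (B l) (r i)))"
      by (subst sum.swap) (simp add: sum_distrib_left)
    also have "\<dots> = (\<Sum>l\<le>j+1. if l = k then JP_J \<alpha> \<beta> \<gamma> j l else 0)"
      unfolding biorthogonal by (intro sum.cong) auto
    also have "\<dots> = JP_J \<alpha> \<beta> \<gamma> j k"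
      using JP_J_eq_0[of j k] by (simp add: not_le)
    finally have 1: "(\<Sum>i\<le>k+2. (if i \<ge> 2 then type_I_coeff k (i - 2) else 0) * \<Phi> (B j) (r i)) = JP_J \<alpha> \<beta> \<gamma> j k" .
    have "(\<Sum>i\<le>k+2. (\<Sum>l\<le>k+2. JP_J \<alpha> \<beta> \<gamma> l k * type_I_coeff l i) * \<Phi> (B j) (r i)) =
          (\<Sum>l\<le>k+2. JP_J \<alpha> \<beta> \<gamma> l k * (\<Sum>i\<le>k+2. type_I_coeff l i * \<Phi> (B j) (r i)))"
      unfolding sum_distrib_left sum_distrib_right by (subst sum.swap) (simp only: mult_ac)
    also have "\<dots> = (\<Sum>l\<le>k+2. if l = j then JP_J \<alpha> \<beta> \<gamma> l k else 0)"
      by (intro sum.cong refl) (auto simp: biorthogonal' simp del: sum.atMost_Suc)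
    also have "\<dots> = JP_J \<alpha> \<beta> \<gamma> j k"
      using j by (subst sum.delta) auto
    finally show "(\<Sum>i\<le>k+2. b i * \<Phi> (B j) (r i)) = 0"
      unfolding b_def left_diff_distrib sum_subtractf 1 by simp
  qed (use assms mellin_B_eq_0 mellin_B_neq_0 in auto)
  thus ?thesis
    by (simp add: b_def)
qed

text \<open>At x = 1 all powers are 1, so the value of a form is the sum of its coefficients, and
  \<open>type_I_recurrence\<close> is summed over \<open>i\<close>.\<close>

lemma Q_at_1_recurrence: "Q_at_1 k = (\<Sum>l\<le>k+2. JP_J \<alpha> \<beta> \<gamma> l k * Q_at_1 l)"
proof -
  have "Q_at_1 k = (\<Sum>i\<le>k+2. if i \<ge> 2 then type_I_coeff k (i - 2) else 0)"
    unfolding add_2_eq_Suc' sum.atMost_Suc_shift by (simp add: Q_at_1_eq_sum[of k k])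
  also have "\<dots> = (\<Sum>i\<le>k+2. \<Sum>l\<le>k+2. JP_J \<alpha> \<beta> \<gamma> l k * type_I_coeff l i)"
    by (intro sum.cong refl type_I_recurrence) auto
  also have "\<dots> = (\<Sum>l\<le>k+2. JP_J \<alpha> \<beta> \<gamma> l k * (\<Sum>i\<le>k+2. type_I_coeff l i))"
    by (subst sum.swap) (simp only: sum_distrib_left)
  also have "\<dots> = (\<Sum>l\<le>k+2. JP_J \<alpha> \<beta> \<gamma> l k * Q_at_1 l)"
    by (intro sum.cong refl) (simp add: Q_at_1_eq_sum[of _ "k + 2"] del: sum.atMost_Suc)
  finally show ?thesis .
qed

text \<open>The moments of the type I form are entries of powers of \<open>J\<close>, hence nonnegative.\<close>

lemma type_I_moment_nonneg: "(\<Sum>i\<le>k. type_I_coeff k i * \<Phi> (monom 1 M * B j) (r i)) \<ge> 0"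
proof (induction M arbitrary: j)
  case 0
  show ?case
    using biorthogonal[of k j] by simp
next
  case (Suc M)
  have "monom 1 (Suc M) * B j = monom 1 M * ([:0, 1:] * B j)"
    by (simp add: monom_Suc)
  also have "\<dots> = (\<Sum>l\<le>j+1. smult (JP_J \<alpha> \<beta> \<gamma> j l) (monom 1 M * B l))"
    unfolding x_times_B by (simp only: sum_distrib_left mult_smult_right)
  finally have "(\<Sum>i\<le>k. type_I_coeff k i * \<Phi> (monom 1 (Suc M) * B j) (r i)) =
      (\<Sum>i\<le>k. \<Sum>l\<le>j+1. JP_J \<alpha> \<beta> \<gamma> j l * (type_I_coeff k i * \<Phi> (monom 1 M * B l) (r i)))"
    by (simp only: mellin_sum[OF \<gamma> r_gt] mellin_smult[OF \<gamma> r_gt] sum_distrib_left mult_ac)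
  also have "\<dots> = (\<Sum>l\<le>j+1. JP_J \<alpha> \<beta> \<gamma> j l * (\<Sum>i\<le>k. type_I_coeff k i * \<Phi> (monom 1 M * B l) (r i)))"
    by (subst sum.swap) (simp only: sum_distrib_left)
  also have "\<dots> \<ge> 0"
    by (intro sum_nonneg mult_nonneg_nonneg JP_J_nonneg Suc)
  finally show ?case .
qed

text \<open>The moments, scaled by M^(\<gamma> + 1), tend to Gamma(\<gamma> + 1) times the value at
  1, because the limit in \<open>mellin_monom_asymp\<close> is the same for all exponents
  \<open>r i\<close>.\<close>

lemma Q_at_1_nonneg: "Q_at_1 k \<ge> 0"
proof -
  have "(\<lambda>M. \<Sum>i\<le>k. type_I_coeff k i * (real M powr (\<gamma> + 1) * \<Phi> (monom 1 (Suc M)) (r i))) \<longlonglongrightarrow>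
          (\<Sum>i\<le>k. type_I_coeff k i * Gamma (\<gamma> + 1))"
    by (intro tendsto_intros mellin_monom_asymp \<gamma> r_gt)
  moreover have "(\<Sum>i\<le>k. type_I_coeff k i * (real M powr (\<gamma> + 1) * \<Phi> (monom 1 (Suc M)) (r i))) \<ge> 0" for M
  proof -
    have "0 \<le> real M powr (\<gamma> + 1) * (\<Sum>i\<le>k. type_I_coeff k i * \<Phi> (monom 1 (Suc M)) (r i))"
      using type_I_moment_nonneg[of k "Suc M" 0] by (simp add: B_0)
    thus ?thesis
      by (simp add: sum_distrib_left mult_ac)
  qed
  ultimately have "(\<Sum>i\<le>k. type_I_coeff k i * Gamma (\<gamma> + 1)) \<ge> 0"
    by (intro LIMSEQ_le_const) auto
  hence "Q_at_1 k * Gamma (\<gamma> + 1) \<ge> 0"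
    by (simp add: Q_at_1_eq_sum[of k k] sum_distrib_right)
  moreover have "Gamma (\<gamma> + 1) > 0"
    using \<gamma> by (intro Gamma_real_pos) simp
  ultimately show ?thesis
    by (simp add: zero_le_mult_iff)
qed

text \<open>All terms of the recurrence are nonnegative, and the one from the preceding form has the
  positive coefficient next to the diagonal of \<open>J\<close>, so positivity propagates from index
  0.\<close>

lemma Q_at_1_pos: "Q_at_1 k > 0"
proof (induction k)
  case 0
  have "Q_at_1 0 * \<Phi> 1 \<alpha> = 1"
    using biorthogonal[of 0 0] by (simp add: Q_at_1_eq_sum[of 0 0] B_0)
  hence "Q_at_1 0 \<noteq> 0"
    by auto
  thus ?case
    using Q_at_1_nonneg[of 0] by simp
next
  case (Suc k)
  have "JP_J \<alpha> \<beta> \<gamma> k (Suc k) = type_II_at_1 k / type_II_at_1 (Suc k) * row k (Suc k)"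
    using type_II_at_1_pos[of k] type_II_at_1_pos[of "Suc k"]
    by (simp flip: JP_P_II_eq_row add: JP_P_II_altdef)
  hence "JP_J \<alpha> \<beta> \<gamma> k (Suc k) * Q_at_1 k > 0"
    using Suc row_up_pos[of k] type_II_at_1_pos by (simp add: divide_pos_pos)
  also have "JP_J \<alpha> \<beta> \<gamma> k (Suc k) * Q_at_1 k \<le> (\<Sum>l\<le>Suc k+2. JP_J \<alpha> \<beta> \<gamma> l (Suc k) * Q_at_1 l)"
    by (rule member_le_sum) (auto intro!: mult_nonneg_nonneg JP_J_nonneg Q_at_1_nonneg)
  also have "\<dots> = Q_at_1 (Suc k)"
    by (rule Q_at_1_recurrence [symmetric])
  finally show ?case .
qed

end

section \<open>Ratio asymptotics of the type I forms at one\<close>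

lemma not_descending:
  fixes y :: "nat \<Rightarrow> real"
  assumes "c > 0" and "\<And>n. n \<ge> N \<Longrightarrow> y (Suc n) \<le> y n - c" and "\<And>n. y n \<ge> 0"
  shows False
proof -
  have "y (N + j) \<le> y N - real j * c" for j
  proof (induction j)
    case (Suc j)
    thus ?case
      using assms(2)[of "N + j"] by (simp add: algebra_simps)
  qed simp
  moreover obtain j where "real j * c > y N"
    using reals_Archimedean3[OF assms(1)] by blast
  ultimately show False
    using assms(3)[of "N + j"] by (smt (verit))
qed

text \<open>The map \<open>y \<mapsto> 2 - 1 / y\<close> decreases \<open>y\<close> by \<open>(1 - y)\<^sup>2 / y\<close>, so a positive orbit cannot stay away from
  its fixed point \<open>1\<close>, even under perturbations tending to zero.\<close>

lemma perturbed_parabolic_orbit: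
  fixes y :: "nat \<Rightarrow> real"
  assumes pos: "\<And>n. y n > 0" and lim: "(\<lambda>n. y (Suc n) + 1 / y n - 2) \<longlonglongrightarrow> 0"
  shows "y \<longlonglongrightarrow> 1"
proof (rule LIMSEQ_I)
  fix \<epsilon> :: real assume "\<epsilon> > 0"
  define \<delta> where "\<delta> = min (\<epsilon> / 2) (1 / 2)"
  have \<delta>: "\<delta> > 0" "\<delta> < 1" "\<delta> < \<epsilon>"
    using \<open>\<epsilon> > 0\<close> by (auto simp: \<delta>_def)
  \<comment> \<open>Outside the \<delta>-neighbourhood of 1 the decrease (1 - y)^2 / y is at least
    \<delta>^2 / (1 + \<delta>) \<ge> 2 \<eta>. A perturbation below \<eta> therefore leaves a net
    decrease of at least \<eta>.\<close>
  define \<eta> where "\<eta> = \<delta>\<^sup>2 / 4"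
  have "\<eta> > 0"
    using \<delta> by (simp add: \<eta>_def)
  then obtain N where N: "\<And>n. n \<ge> N \<Longrightarrow> \<bar>y (Suc n) + 1 / y n - 2\<bar> < \<eta>"
    using LIMSEQ_D[OF lim] by force
  have id: "y n + 1 / y n - 2 = (1 - y n)\<^sup>2 / y n" for n
    using pos[of n] by (simp add: field_simps power2_eq_square)
  have step: "y (Suc n) \<le> y n - (1 - y n)\<^sup>2 / y n + \<eta>" if "n \<ge> N" for n
    using N[OF that] id[of n] by linarith
  \<comment> \<open>Once below 1 - \<delta>, the orbit would keep decreasing by \<eta> and become
    negative.\<close>
  have low: "y n \<ge> 1 - \<delta>" if n: "n \<ge> N" for n
  proof (rule ccontr)
    assume "\<not> y n \<ge> 1 - \<delta>"
    have descend: "y (Suc m) \<le> y m - \<eta>" if "m \<ge> N" "y m < 1 - \<delta>" for m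
    proof -
      have "\<delta>\<^sup>2 \<le> (1 - y m)\<^sup>2"
        using that \<delta> by (intro power_mono) auto
      also have "\<dots> \<le> (1 - y m)\<^sup>2 / y m"
        using that \<delta> pos[of m] by (simp add: field_simps mult_left_le_one_le mult_left_le)
      finally show ?thesis
        using step[OF that(1)] \<open>\<eta> > 0\<close> unfolding \<eta>_def by linarith
    qed
    have "y m < 1 - \<delta>" if "m \<ge> n" for m
      using that
    proof (induction rule: dec_induct)
      case (step m)
      thus ?case
        using descend[of m] n \<open>\<eta> > 0\<close> by linarith
    qed (use \<open>\<not> y n \<ge> 1 - \<delta>\<close> in simp)
    thus False
      using not_descending[of \<eta> n y] descend \<open>\<eta> > 0\<close> n pos by (meson less_imp_le order.trans)
  qed
  have \<eta>_le: "2 * \<eta> \<le> \<delta>\<^sup>2 / (1 + \<delta>)"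
  proof -
    have "\<delta>\<^sup>2 * (1 + \<delta>) \<le> \<delta>\<^sup>2 * 2"
      using \<delta> by (intro mult_left_mono) auto
    thus ?thesis
      using \<delta> by (simp add: \<eta>_def field_simps)
  qed
  obtain n0 where n0: "n0 \<ge> N" "y n0 \<le> 1 + \<delta>"
  proof (rule ccontr)
    assume "\<not> thesis"
    hence large: "y n > 1 + \<delta>" if "n \<ge> N" for n
      using that not_le \<open>\<And>n0. N \<le> n0 \<Longrightarrow> y n0 \<le> 1 + \<delta> \<Longrightarrow> thesis\<close> by blast
    have "y (Suc n) \<le> y n - \<eta>" if "n \<ge> N" for n
    proof -
      have "1 / y n \<le> 1 / (1 + \<delta>)"
        using large[OF that] \<delta> by (intro divide_left_mono) auto
      moreover have "\<delta>\<^sup>2 / (1 + \<delta>) = (1 + \<delta>) + 1 / (1 + \<delta>) - 2"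
        using \<delta> by (simp add: field_simps power2_eq_square)
      moreover have "(1 - y n)\<^sup>2 / y n \<ge> \<delta>\<^sup>2 / (1 + \<delta>)"
      proof -
        have "0 \<le> (y n - (1 + \<delta>)) * ((1 + \<delta>) * y n - 1)"
          using large[OF that] \<delta> mult_mono[of 1 "1 + \<delta>" 1 "y n"] by (intro mult_nonneg_nonneg) auto
        also have "\<dots> = (1 - y n)\<^sup>2 * (1 + \<delta>) - \<delta>\<^sup>2 * y n"
          by (simp add: power2_eq_square algebra_simps)
        finally show ?thesis
          using \<delta> pos[of n] by (simp add: field_simps)
      qed
      ultimately show ?thesis
        using step[OF that] \<eta>_le \<open>\<eta> > 0\<close> by linarith
    qed
    thus False
      using not_descending[of \<eta> N y] \<open>\<eta> > 0\<close> pos by (meson less_imp_le)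
  qed
  \<comment> \<open>The map is increasing and sends 1 + \<delta> to a value at most 1 + \<delta> - 2
    \<eta>, so the perturbed orbit cannot leave upwards again.\<close>
  have up: "y n \<le> 1 + \<delta>" if "n \<ge> n0" for n
    using that
  proof (induction rule: dec_induct)
    case (step n)
    have "1 / y n \<ge> 1 / (1 + \<delta>)"
      using step.IH pos[of n] \<delta> by (intro divide_left_mono) auto
    moreover have "2 - 1 / (1 + \<delta>) = 1 + \<delta> - \<delta>\<^sup>2 / (1 + \<delta>)"
      using \<delta> by (simp add: field_simps power2_eq_square)
    ultimately show ?case
      using N[of n] step.hyps n0(1) \<eta>_le \<open>\<eta> > 0\<close> by linarith
  qed (use n0 in simp)
  show "\<exists>n0. \<forall>n\<ge>n0. norm (y n - 1) < \<epsilon>"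
  proof (intro exI allI impI)
    fix n assume "n \<ge> n0"
    thus "norm (y n - 1) < \<epsilon>"
      using low[of n] up[of n] \<delta> n0(1) by (simp add: abs_less_iff)
  qed
qed

text \<open>Iterating towards larger indices multiplies the a priori bound \<open>C\<close> by q^j,
  while the errors form a geometric series with sum at most \<epsilon> / 2.\<close>

lemma backward_contraction:
  fixes e \<delta> :: "nat \<Rightarrow> real"
  assumes q: "0 \<le> q" "q < 1" and bound: "\<And>n. n \<ge> N \<Longrightarrow> e n \<le> C"
    and nonneg: "\<And>n. e n \<ge> 0" and \<delta>: "\<delta> \<longlonglongrightarrow> 0"
    and step: "\<And>n. n \<ge> N \<Longrightarrow> e n \<le> q * e (Suc n) + \<delta> n"
  shows "e \<longlonglongrightarrow> 0"
proof (rule LIMSEQ_I)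
  fix \<epsilon> :: real assume "\<epsilon> > 0"
  hence "\<epsilon> / 2 * (1 - q) > 0"
    using q by simp
  then obtain M where M: "\<And>n. n \<ge> M \<Longrightarrow> \<bar>\<delta> n\<bar> < \<epsilon> / 2 * (1 - q)"
    using LIMSEQ_D[OF \<delta>, of "\<epsilon> / 2 * (1 - q)"] by auto
  have iter: "e n \<le> q ^ j * C + \<epsilon> / 2" if "n \<ge> max M N" for n j
    using that
  proof (induction j arbitrary: n)
    case 0
    thus ?case
      using bound[of n] \<open>\<epsilon> > 0\<close> by simp
  next
    case (Suc j)
    have "e n \<le> q * e (Suc n) + \<delta> n"
      using step Suc.prems by simp
    also have "\<dots> \<le> q * (q ^ j * C + \<epsilon> / 2) + \<epsilon> / 2 * (1 - q)"
      using Suc q M[of n] by (intro add_mono mult_left_mono) auto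
    also have "\<dots> = q ^ Suc j * C + \<epsilon> / 2"
      by (simp add: field_simps)
    finally show ?case .
  qed
  have "(\<lambda>j. q ^ j * C) \<longlonglongrightarrow> 0"
    using q by (intro tendsto_mult_left_zero LIMSEQ_power_zero) auto
  from LIMSEQ_D[OF this, of "\<epsilon> / 2"] obtain j where j: "\<bar>q ^ j * C\<bar> < \<epsilon> / 2"
    using \<open>\<epsilon> > 0\<close> by auto
  show "\<exists>n0. \<forall>n\<ge>n0. norm (e n - 0) < \<epsilon>"
  proof (intro exI allI impI)
    fix n assume "n \<ge> max M N"
    thus "norm (e n - 0) < \<epsilon>"
      using iter[of n j] nonneg[of n] j by simp
  qed
qed

text \<open>The limiting recurrence has the characteristic polynomial \<open>(z - 1)\<^sup>2 (z + 8)\<close>. Positivity excludes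
  the root \<open>-8\<close>: passing to \<open>u (m + 1) + 8 u m\<close> removes it, and what remains is a perturbed
  second difference.\<close>

lemma positive_solution_ratio:
  fixes u :: "nat \<Rightarrow> real"
  assumes pos: "\<And>m. u m > 0"
    and rec: "\<And>m. u (Suc m) = A m * u m + B m * u (Suc m) + C m * u (Suc (Suc m)) +
                D m * u (Suc (Suc (Suc m)))"
    and lim: "A \<longlonglongrightarrow> 8 / 27" "B \<longlonglongrightarrow> 12 / 27" "C \<longlonglongrightarrow> 6 / 27" "D \<longlonglongrightarrow> 1 / 27"
  shows "(\<lambda>m. u (Suc m) / u m) \<longlonglongrightarrow> 1"
proof -
  define x where "x = (\<lambda>m. u (Suc m) / u m)"
  define y where "y = (\<lambda>m. (u (Suc (Suc m)) + 8 * u (Suc m)) / (u (Suc m) + 8 * u m))"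
  \<comment> \<open>In terms of \<open>u\<close>, this is 27 times the right-hand side of the
    limiting recurrence divided by \<open>u (Suc m)\<close>, so it should tend to 27.\<close>
  define S where "S = (\<lambda>m. 8 / x m + 12 + 6 * x (Suc m) + x (Suc m) * x (Suc (Suc m)))"
  have x_pos: "x m > 0" and y_pos: "y m > 0" for m
    using pos[of m] pos[of "Suc m"] pos[of "Suc (Suc m)"] by (simp_all add: x_def y_def add_pos_pos)
  have rec_x: "1 = A m / x m + B m + C m * x (Suc m) + D m * (x (Suc m) * x (Suc (Suc m)))" for m
  proof -
    have "1 = u (Suc m) / u (Suc m)"
      using pos[of "Suc m"] by simp
    also have "\<dots> = (A m * u m + B m * u (Suc m) + C m * u (Suc (Suc m)) +
                D m * u (Suc (Suc (Suc m)))) / u (Suc m)"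
      by (subst (1) rec) (rule refl)
    also have "\<dots> = A m / x m + B m + C m * x (Suc m) + D m * (x (Suc m) * x (Suc (Suc m)))"
      using pos[of m] pos[of "Suc m"] pos[of "Suc (Suc m)"] by (simp add: x_def add_divide_distrib)
    finally show ?thesis .
  qed
  have "\<forall>\<^sub>F m in sequentially. A m > 4 / 27 \<and> B m > 0 \<and> C m > 3 / 27 \<and> D m > 0"
    by (intro eventually_conj order_tendstoD(1)[OF lim(1)] order_tendstoD(1)[OF lim(2)]
          order_tendstoD(1)[OF lim(3)] order_tendstoD(1)[OF lim(4)]) simp_all
  then obtain N where N: "\<And>m. m \<ge> N \<Longrightarrow> A m > 4 / 27 \<and> B m > 0 \<and> C m > 3 / 27 \<and> D m > 0"
    unfolding eventually_sequentially by blast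
  \<comment> \<open>The terms of \<open>rec_x\<close> are nonnegative and sum to 1, so each is at
    most 1. The lower bounds on \<open>A\<close> and \<open>C\<close> then give 27/4 \<le> 7 and
    27/3 = 9.\<close>
  have bounds: "1 / x m \<le> 7" "x (Suc m) \<le> 9" if "m \<ge> N" for m
  proof -
    have "A m / x m \<ge> 0" "C m * x (Suc m) \<ge> 0" "D m * (x (Suc m) * x (Suc (Suc m))) \<ge> 0" "B m \<ge> 0"
      using N[OF that] x_pos[of m] x_pos[of "Suc m"] x_pos[of "Suc (Suc m)"] by auto
    hence "A m / x m \<le> 1" "C m * x (Suc m) \<le> 1"
      using rec_x[of m] by linarith+
    moreover have "4 / 27 * (1 / x m) \<le> A m * (1 / x m)" "3 / 27 * x (Suc m) \<le> C m * x (Suc m)"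
      using N[OF that] x_pos[of m] x_pos[of "Suc m"] by (intro mult_right_mono; simp)+
    moreover have "A m * (1 / x m) = A m / x m"
      by simp
    moreover have "1 / x m > 0"
      using x_pos[of m] by simp
    ultimately show "1 / x m \<le> 7" "x (Suc m) \<le> 9"
      by linarith+
  qed
  have S: "(\<lambda>m. S m - 27) \<longlonglongrightarrow> 0"
  proof (rule Lim_null_comparison)
    define E where "E = (\<lambda>m. \<bar>8 - 27 * A m\<bar> * 7 + \<bar>12 - 27 * B m\<bar> + \<bar>6 - 27 * C m\<bar> * 9 + \<bar>1 - 27 * D m\<bar> * 81)"
    have "E \<longlonglongrightarrow> \<bar>8 - 27 * (8 / 27)\<bar> * 7 + \<bar>12 - 27 * (12 / 27)\<bar> + \<bar>6 - 27 * (6 / 27)\<bar> * 9 +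
                    \<bar>1 - 27 * (1 / 27 :: real)\<bar> * 81"
      unfolding E_def by (intro tendsto_intros lim)
    thus "E \<longlonglongrightarrow> 0"
      by simp
    have "norm (S m - 27) \<le> E m" if "m \<ge> N" for m
    proof -
      have "S m - 27 = (8 - 27 * A m) * (1 / x m) + (12 - 27 * B m) + (6 - 27 * C m) * x (Suc m) +
              (1 - 27 * D m) * (x (Suc m) * x (Suc (Suc m)))"
      proof -
        have "(8 - 27 * A m) * (1 / x m) = 8 / x m - 27 * (A m / x m)"
          by (simp add: diff_divide_distrib)
        moreover have "(6 - 27 * C m) * x (Suc m) = 6 * x (Suc m) - 27 * (C m * x (Suc m))"
          by (simp add: algebra_simps)
        moreover have "(1 - 27 * D m) * (x (Suc m) * x (Suc (Suc m))) =
            x (Suc m) * x (Suc (Suc m)) - 27 * (D m * (x (Suc m) * x (Suc (Suc m))))"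
          by (simp add: algebra_simps)
        ultimately show ?thesis
          using rec_x[of m] unfolding S_def by linarith
      qed
      also have "norm \<dots> \<le> \<bar>8 - 27 * A m\<bar> * \<bar>1 / x m\<bar> + \<bar>12 - 27 * B m\<bar> + \<bar>6 - 27 * C m\<bar> * \<bar>x (Suc m)\<bar> +
              \<bar>1 - 27 * D m\<bar> * \<bar>x (Suc m) * x (Suc (Suc m))\<bar>"
        unfolding real_norm_def abs_mult [symmetric] by linarith
      also have "\<dots> \<le> E m"
        unfolding E_def
      proof (intro add_mono mult_left_mono order.refl)
        have "x (Suc m) * x (Suc (Suc m)) \<le> 9 * 9"
          using bounds(2)[of m] bounds(2)[of "Suc m"] that x_pos[of "Suc m"] x_pos[of "Suc (Suc m)"]
          by (intro mult_mono) auto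
        thus "\<bar>x (Suc m) * x (Suc (Suc m))\<bar> \<le> 81"
          using x_pos[of "Suc m"] x_pos[of "Suc (Suc m)"] by (simp add: abs_mult)
      qed (use bounds[OF that] x_pos[of m] x_pos[of "Suc m"] in auto)
      finally show ?thesis .
    qed
    thus "\<forall>\<^sub>F m in sequentially. norm (S m - 27) \<le> E m"
      unfolding eventually_sequentially by blast
  qed
  have "y \<longlonglongrightarrow> 1"
  proof (rule perturbed_parabolic_orbit)
    show "(\<lambda>m. y (Suc m) + 1 / y m - 2) \<longlonglongrightarrow> 0"
    proof (rule Lim_null_comparison)
      show "(\<lambda>m. \<bar>S m - 27\<bar>) \<longlonglongrightarrow> 0"
        using S by (simp add: tendsto_rabs_zero_iff)
      have "norm (y (Suc m) + 1 / y m - 2) \<le> \<bar>S m - 27\<bar>" for m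
      proof -
        define v where "v = u (Suc (Suc m)) + 8 * u (Suc m)"
        note p = pos[of m] pos[of "Suc m"] pos[of "Suc (Suc m)"] pos[of "Suc (Suc (Suc m))"]
        have v: "v > u (Suc m)"
          using p by (simp add: v_def)
        have "y (Suc m) + 1 / y m - 2 =
           (u (Suc (Suc (Suc m))) + 8 * u (Suc (Suc m)) + (u (Suc m) + 8 * u m) - 2 * v) / v"
        proof -
          have "y (Suc m) = (u (Suc (Suc (Suc m))) + 8 * u (Suc (Suc m))) / v"
            "1 / y m = (u (Suc m) + 8 * u m) / v"
            by (simp_all add: y_def v_def)
          thus ?thesis
            using v p by (simp only:) (simp add: field_simps)
        qed
        \<comment> \<open>The numerator is the second difference of
          \<open>u (Suc m) + 8 * u m\<close>. It matches the expansion (z - 1)^2 (z + 8) = z^3 + 6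
          z^2 - 15 z + 8.\<close>
        also have "\<dots> = u (Suc m) / v * (S m - 27)"
        proof -
          have "S m - 27 = (u (Suc (Suc (Suc m))) + 6 * u (Suc (Suc m)) - 15 * u (Suc m) + 8 * u m) / u (Suc m)"
            using p by (simp add: S_def x_def field_simps)
          thus ?thesis
            using p by (simp add: v_def)
        qed
        finally have "norm (y (Suc m) + 1 / y m - 2) = u (Suc m) / v * \<bar>S m - 27\<bar>"
          using p v by (simp add: abs_mult)
        also have "\<dots> \<le> 1 * \<bar>S m - 27\<bar>"
          using p v by (intro mult_right_mono) auto
        finally show ?thesis
          by simp
      qed
      thus "\<forall>\<^sub>F m in sequentially. norm (y (Suc m) + 1 / y m - 2) \<le> \<bar>S m - 27\<bar>"
        by simp
    qed
  qed (rule y_pos)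
  then obtain M where M: "\<And>m. m \<ge> M \<Longrightarrow> y m < 2"
    using order_tendstoD(2)[of y 1 sequentially 2] unfolding eventually_sequentially by auto
  \<comment> \<open>The relation y (x + 8) = x (x' + 8), with x' the next ratio, is solved for x in
    terms of x'. As \<open>y m < 2\<close>, the factor x' + 8 - y exceeds 6, which gives the
    contraction constant 1/6.\<close>
  have "(\<lambda>m. \<bar>x m - 1\<bar>) \<longlonglongrightarrow> 0"
  proof (rule backward_contraction)
    show "(\<lambda>m. 9 / 6 * \<bar>y m - 1\<bar>) \<longlonglongrightarrow> 0"
      using \<open>y \<longlonglongrightarrow> 1\<close> by (intro tendsto_mult_right_zero) (simp add: tendsto_rabs_zero_iff LIM_zero_iff)
    show "\<bar>x m - 1\<bar> \<le> 10" if "m \<ge> max M (Suc N)" for m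
      using that bounds(2)[of "m - 1"] x_pos[of m] by (cases m) auto
    show "\<bar>x m - 1\<bar> \<le> 1 / 6 * \<bar>x (Suc m) - 1\<bar> + 9 / 6 * \<bar>y m - 1\<bar>" if "m \<ge> max M (Suc N)" for m
    proof -
      have "y m = x m * (x (Suc m) + 8) / (x m + 8)"
      proof -
        have "x (Suc m) + 8 = (u (Suc (Suc m)) + 8 * u (Suc m)) / u (Suc m)"
          "x m + 8 = (u (Suc m) + 8 * u m) / u m"
          using pos[of m] pos[of "Suc m"] by (simp_all add: x_def add_divide_distrib)
        thus ?thesis
          using pos[of m] pos[of "Suc m"] by (simp add: x_def y_def)
      qed
      hence "y m * (x m + 8) = x m * (x (Suc m) + 8)"
        using x_pos[of m] by simp
      hence "(x m - 1) * (x (Suc m) + 8 - y m) = 9 * (y m - 1) - (x (Suc m) - 1)"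
        by (simp add: algebra_simps)
      hence eq: "\<bar>x m - 1\<bar> * \<bar>x (Suc m) + 8 - y m\<bar> = \<bar>9 * (y m - 1) - (x (Suc m) - 1)\<bar>"
        by (simp only: abs_mult [symmetric])
      have "\<bar>x m - 1\<bar> * 6 \<le> \<bar>x m - 1\<bar> * \<bar>x (Suc m) + 8 - y m\<bar>"
        using M[of m] that x_pos[of "Suc m"] by (intro mult_left_mono) auto
      also have "\<dots> \<le> \<bar>9 * (y m - 1)\<bar> + \<bar>x (Suc m) - 1\<bar>"
        unfolding eq by (rule abs_triangle_ineq4)
      also have "\<bar>9 * (y m - 1)\<bar> = 9 * \<bar>y m - 1\<bar>"
        unfolding abs_mult by simp
      finally show ?thesis
        by simp
    qed
  qed auto
  thus ?thesis
    unfolding x_def by (simp add: tendsto_rabs_zero_iff LIM_zero_iff)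
qed

section \<open>The invariant measure and the comparison of the two matrices\<close>

context jacobi_pineiro
begin

definition u :: "nat \<Rightarrow> real" where
  "u k = type_II_at_1 k * Q_at_1 k"

lemma u_pos: "u k > 0"
  unfolding u_def by (intro mult_pos_pos type_II_at_1_pos Q_at_1_pos)

lemma JP_P_I_altdef: "JP_P_I \<alpha> \<beta> \<gamma> k l = u l / u k * row l k"
  using type_II_at_1_pos[of k] type_II_at_1_pos[of l] Q_at_1_pos[of k]
  by (simp add: JP_P_I_def u_def JP_P_II_altdef flip: JP_P_II_eq_row)

lemma u_invariant: "u k = (\<Sum>l\<le>k+2. row l k * u l)"
proof -
  have "u k = (\<Sum>l\<le>k+2. type_II_at_1 k * (JP_J \<alpha> \<beta> \<gamma> l k * Q_at_1 l))"
    unfolding u_def by (subst Q_at_1_recurrence) (rule sum_distrib_left)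
  also have "\<dots> = (\<Sum>l\<le>k+2. row l k * u l)"
    using type_II_at_1_pos
    by (intro sum.cong refl) (simp add: u_def JP_P_II_altdef less_imp_neq[symmetric] flip: JP_P_II_eq_row)
  finally show ?thesis .
qed

lemma u_ratio: "(\<lambda>k. u (Suc k) / u k) \<longlonglongrightarrow> 1"
proof (rule positive_solution_ratio)
  fix m
  have "u (Suc m) = (\<Sum>l\<in>{m, Suc m, Suc (Suc m), Suc (Suc (Suc m))}. row l (Suc m) * u l)"
    by (subst u_invariant, rule sum.mono_neutral_right) (auto simp: row_eq_0)
  thus "u (Suc m) = row m (Suc m) * u m + row (Suc m) (Suc m) * u (Suc m) +
      row (Suc (Suc m)) (Suc m) * u (Suc (Suc m)) +
      row (Suc (Suc (Suc m))) (Suc m) * u (Suc (Suc (Suc m)))"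
    by simp
next
  show "(\<lambda>m. row m (Suc m)) \<longlonglongrightarrow> 8 / 27"
    by (rule LIMSEQ_offset[where k = 2]) (use row_limits(1) in \<open>simp add: numeral_3_eq_3\<close>)
  show "(\<lambda>m. row (Suc m) (Suc m)) \<longlonglongrightarrow> 12 / 27"
    by (rule LIMSEQ_offset[where k = 1]) (use row_limits(2) in simp)
  show "(\<lambda>m. row (Suc (Suc m)) (Suc m)) \<longlonglongrightarrow> 6 / 27"
    using row_limits(3) by simp
  show "(\<lambda>m. row (Suc (Suc (Suc m))) (Suc m)) \<longlonglongrightarrow> 1 / 27"
    using LIMSEQ_ignore_initial_segment[OF row_limits(4), of 1] by simp
qed (rule u_pos)

end

theorem proposition11:
  fixes \<alpha> \<beta> \<gamma> :: real and k :: int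
  assumes "\<alpha> > -1" and "\<beta> > -1" and "\<gamma> > -1"
    and "\<alpha> \<noteq> \<beta>" and "\<bar>\<alpha> - \<beta>\<bar> < 1"
    and "k \<in> {-1, 0, 1, 2}"
  shows "\<exists>L. (\<lambda>n. JP_P_I \<alpha> \<beta> \<gamma> n (nat (int n + k))) \<longlonglongrightarrow> L \<and>
             (\<lambda>n. JP_P_II \<alpha> \<beta> \<gamma> (nat (int n + k)) n) \<longlonglongrightarrow> L"
proof -
  interpret jacobi_pineiro \<alpha> \<beta> \<gamma>
    by unfold_locales (use assms in auto)
  \<comment> \<open>By \<open>JP_P_I_altdef\<close> the type I entry is the transposed type II entry
    times a ratio of values of \<open>u\<close>; it remains to see that the entry converges and the
    ratio tends to 1.\<close>
  have "\<exists>L. (\<lambda>n. row (nat (int n + k)) n) \<longlonglongrightarrow> L \<and> (\<lambda>n. u (nat (int n + k)) / u n) \<longlonglongrightarrow> 1"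
  proof -
    consider "k = -1" | "k = 0" | "k = 1" | "k = 2"
      using assms(6) by blast
    thus ?thesis
    proof cases
      case 1
      \<comment> \<open>For k = -1 the index is truncated to 0 at n = 0. The offset passes over this
        value and also over the exceptional rows 0 and 1.\<close>
      have "(\<lambda>n. row (nat (int n + k)) n) \<longlonglongrightarrow> 8 / 27"
        by (rule LIMSEQ_offset[where k = 3])
           (use row_limits(1) 1 in \<open>simp add: nat_add_distrib\<close>)
      moreover have "(\<lambda>n. u (nat (int n + k)) / u n) \<longlonglongrightarrow> 1"
      proof (rule LIMSEQ_offset[where k = 1])
        have "(\<lambda>n. inverse (u (Suc n) / u n)) \<longlonglongrightarrow> inverse 1"
          by (intro tendsto_intros u_ratio) simp
        thus "(\<lambda>n. u (nat (int (n + 1) + k)) / u (n + 1)) \<longlonglongrightarrow> 1"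
          using 1 by simp
      qed
      ultimately show ?thesis
        by blast
    next
      case 2
      have nat: "nat (int n + k) = n" for n
        using 2 by simp
      have "(\<lambda>n. row (nat (int n + k)) n) \<longlonglongrightarrow> 12 / 27"
        unfolding nat by (rule LIMSEQ_offset[where k = 2]) (rule row_limits(2))
      moreover have "u n / u n = 1" for n
        using u_pos[of n] by simp
      hence "(\<lambda>n. u (nat (int n + k)) / u n) \<longlonglongrightarrow> 1"
        using 2 by simp
      ultimately show ?thesis
        by blast
    next
      case 3
      have nat: "nat (int n + k) = Suc n" for n
        using 3 by simp
      have "(\<lambda>n. row (nat (int n + k)) n) \<longlonglongrightarrow> 6 / 27"
        unfolding nat by (rule LIMSEQ_offset[where k = 1]) (use row_limits(3) in simp)
      thus ?thesis
        using u_ratio unfolding nat by blast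
    next
      case 4
      have nat: "nat (int n + k) = n + 2" for n
        using 4 by simp
      have "(\<lambda>n. u (Suc (Suc n)) / u (Suc n) * (u (Suc n) / u n)) \<longlonglongrightarrow> 1 * 1"
        by (intro tendsto_mult u_ratio LIMSEQ_Suc[OF u_ratio])
      also have "(\<lambda>n. u (Suc (Suc n)) / u (Suc n) * (u (Suc n) / u n)) = (\<lambda>n. u (n + 2) / u n)"
        using u_pos by (auto simp: fun_eq_iff less_imp_neq[symmetric])
      finally show ?thesis
        using row_limits(4) unfolding nat by auto
    qed
  qed
  then obtain L where L: "(\<lambda>n. row (nat (int n + k)) n) \<longlonglongrightarrow> L"
    and ratio: "(\<lambda>n. u (nat (int n + k)) / u n) \<longlonglongrightarrow> 1"
    by blast
  have "(\<lambda>n. u (nat (int n + k)) / u n * row (nat (int n + k)) n) \<longlonglongrightarrow> 1 * L"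
    by (intro tendsto_mult ratio L)
  thus ?thesis
    using L unfolding JP_P_I_altdef JP_P_II_eq_row by auto
qed

end
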